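(* Let $H$ be a separable Hilbert space, let $T>0$, and let $A$ and $\widetilde A$ generate $C_0$-semigroups $S$ and $\widetilde S$ on $H$. Let $L=Z$ be an $H$-valued purely jump Lévy process, with no deterministic drift and no Gaussian part, and let $$X^A(t)=\int_0^t S(t-s)\,dZ_s,\qquad X^{\widetilde A}(t)=\int_0^t\widetilde S(t-s)\,dZ_s,\qquad 0\le t\le T .$$ If $\mathcal L(X^A)\ll\mathcal L(X^{\widetilde A})$ on $D([0,T];H)$, then almost surely $X^A(t)=X^{\widetilde A}(t)$ for all $t\in[0,T]$.
   Context: $D([0,T];H)$ is the space of càdlàg functions $[0,T]\to H$ with the Skorohod $J_1$ topology; its Borel $\sigma$-algebra is generated by the point evaluations. $\mathcal L(\cdot)$ denotes the law of a random element and $\ll$ is absolute continuity of measures. A general $H$-valued Lévy process has the Lévy--Itô decomposition $L_t=bt+W_t+Z_t$ with $b\in H$, $W$ a $Q$-Wiener process, and $Z$ the (compensated small jumps plus large jumps) jump part, independent of $W$; "purely jump, with no deterministic drift and no Gaussian part" means $b=0$ and $W\equiv 0$, so $L=Z$. The processes $X^A$ and $X^{\widetilde A}$ are regarded as random elements of $D([0,T];H)$ (i.e. càdlàg versions are used). *)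

theory Defs
  imports "HOL-Probability.Probability"
begin

definition C0_semigroup :: "(real \<Rightarrow> 'h \<Rightarrow>\<^sub>L 'h::real_normed_vector) \<Rightarrow> bool" where
  "C0_semigroup S \<longleftrightarrow>
     S 0 = id_blinfun \<and>
     (\<forall>s\<ge>0. \<forall>t\<ge>0. S (s + t) = S s o\<^sub>L S t) \<and>
     (\<forall>x. ((\<lambda>t. blinfun_apply (S t) x) \<longlongrightarrow> x) (at_right 0))"

(* The unbounded operator A is given by its domain D and by its values on D; its values outside D
   are irrelevant. *)
definition generates_C0_semigroup ::
  "'h set \<Rightarrow> ('h \<Rightarrow> 'h) \<Rightarrow> (real \<Rightarrow> 'h \<Rightarrow>\<^sub>L 'h::real_normed_vector) \<Rightarrow> bool" where
  "generates_C0_semigroup D A S \<longleftrightarrow>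
     C0_semigroup S \<and>
     D = {x. \<exists>y. ((\<lambda>t. (blinfun_apply (S t) x - x) /\<^sub>R t) \<longlongrightarrow> y) (at_right 0)} \<and>
     (\<forall>x\<in>D. ((\<lambda>t. (blinfun_apply (S t) x - x) /\<^sub>R t) \<longlongrightarrow> A x) (at_right 0))"

definition cadlag_on :: "real set \<Rightarrow> (real \<Rightarrow> 'h::topological_space) \<Rightarrow> bool" where
  "cadlag_on I f \<longleftrightarrow>
     (\<forall>t\<in>I. (f \<longlongrightarrow> f t) (at t within I \<inter> {t<..})) \<and>
     (\<forall>t\<in>I. \<exists>l. (f \<longlongrightarrow> l) (at t within I \<inter> {..<t}))"

(* D([0,T];H) as a measurable space. Paths are represented by functions on the reals that are
   undefined outside [0,T]. The trace of the product sigma-algebra is the one generated by the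
   point evaluations, i.e. the Borel sigma-algebra of the Skorohod J1 topology.
   Only the sets of this measure space matter. *)
definition skorokhod_space :: "real \<Rightarrow> (real \<Rightarrow> 'h::topological_space) measure" where
  "skorokhod_space T = restrict_space (PiM {0..T} (\<lambda>_. borel)) {f. cadlag_on {0..T} f}"

definition levy_process ::
  "'w measure \<Rightarrow> (real \<Rightarrow> 'w \<Rightarrow> 'h::{real_inner, banach, second_countable_topology}) \<Rightarrow> bool" where
  "levy_process M Z \<longleftrightarrow>
     (\<forall>t\<ge>0. Z t \<in> borel_measurable M) \<and>
     (AE \<omega> in M. Z 0 \<omega> = 0) \<and>
     (\<forall>(n::nat) p. 0 \<le> p 0 \<and> (\<forall>i<n. p i < p (Suc i)) \<longrightarrow>
        prob_space.indep_vars M (\<lambda>_. borel) (\<lambda>i \<omega>. Z (p (Suc i)) \<omega> - Z (p i) \<omega>) {..<n}) \<and>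
     (\<forall>s\<ge>0. \<forall>h\<ge>0. distr M borel (\<lambda>\<omega>. Z (s + h) \<omega> - Z s \<omega>) =
        distr M borel (\<lambda>\<omega>. Z h \<omega> - Z 0 \<omega>)) \<and>
     (\<forall>t\<ge>0. \<forall>\<epsilon>>0. ((\<lambda>s. measure M {\<omega> \<in> space M. \<epsilon> < norm (Z s \<omega> - Z t \<omega>)}) \<longlongrightarrow> 0)
        (at t within {0..})) \<and>
     (AE \<omega> in M. cadlag_on {0..} (\<lambda>t. Z t \<omega>))"

definition jump :: "(real \<Rightarrow> 'h::real_normed_vector) \<Rightarrow> real \<Rightarrow> 'h" where
  "jump f t = f t - Lim (at_left t) f"

definition jump_times :: "(real \<Rightarrow> 'h::real_normed_vector) \<Rightarrow> real \<Rightarrow> 'h set \<Rightarrow> real set" where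
  "jump_times f t B = {s \<in> {0<..t}. jump f s \<in> B}"

definition jump_sum :: "(real \<Rightarrow> 'h::real_normed_vector) \<Rightarrow> real \<Rightarrow> 'h set \<Rightarrow> 'h" where
  "jump_sum f t B = (\<Sum>s\<in>jump_times f t B. jump f s)"

(* nu(B) is the expected number of jumps with value in B during the time interval (0,1]. *)
definition levy_measure ::
  "'w measure \<Rightarrow> (real \<Rightarrow> 'w \<Rightarrow> 'h::real_normed_vector) \<Rightarrow> 'h measure" where
  "levy_measure M Z = measure_of UNIV (sets borel)
     (\<lambda>B. \<integral>\<^sup>+\<omega>. emeasure (count_space UNIV) (jump_times (\<lambda>t. Z t \<omega>) 1 (B - {0})) \<partial>M)"

definition large_jumps :: "(real \<Rightarrow> 'w \<Rightarrow> 'h::real_normed_vector) \<Rightarrow> real \<Rightarrow> 'w \<Rightarrow> 'h" where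
  "large_jumps Z t \<omega> = jump_sum (\<lambda>s. Z s \<omega>) t {x. 1 \<le> norm x}"

definition compensated_small_jumps ::
  "'w measure \<Rightarrow> (real \<Rightarrow> 'w \<Rightarrow> 'h::{banach, second_countable_topology}) \<Rightarrow> real \<Rightarrow> real \<Rightarrow> 'w \<Rightarrow> 'h"
where
  "compensated_small_jumps M Z \<epsilon> t \<omega> =
     jump_sum (\<lambda>s. Z s \<omega>) t {x. \<epsilon> \<le> norm x \<and> norm x < 1}
     - t *\<^sub>R (LINT x:{x. \<epsilon> \<le> norm x \<and> norm x < 1}|levy_measure M Z. x)"

(* Z coincides with the jump part of its own Levy-Ito decomposition: the compensated Poisson
   integral of the jumps of norm < 1, which is the L2-limit for eps -> 0 of the compensated sums of
   the jumps of norm in [eps,1), plus the sum of the jumps of norm >= 1. *)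
definition purely_jump ::
  "'w measure \<Rightarrow> (real \<Rightarrow> 'w \<Rightarrow> 'h::{banach, second_countable_topology}) \<Rightarrow> bool" where
  "purely_jump M Z \<longleftrightarrow>
     (\<forall>t\<ge>0. ((\<lambda>\<epsilon>. \<integral>\<^sup>+\<omega>. ennreal ((norm (Z t \<omega> -
          (compensated_small_jumps M Z \<epsilon> t \<omega> + large_jumps Z t \<omega>)))\<^sup>2) \<partial>M) \<longlongrightarrow> 0) (at_right 0))"

definition partition_of :: "real \<Rightarrow> nat \<Rightarrow> (nat \<Rightarrow> real) \<Rightarrow> bool" where
  "partition_of t n p \<longleftrightarrow> p 0 = 0 \<and> p n = t \<and> (\<forall>i<n. p i < p (Suc i))"

(* The integral of the step function that equals F (p i) on (p i, p (i + 1)]. *)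
definition stochastic_sum ::
  "(real \<Rightarrow> 'w \<Rightarrow> 'h) \<Rightarrow> (real \<Rightarrow> 'h \<Rightarrow>\<^sub>L 'h::real_normed_vector) \<Rightarrow> nat \<Rightarrow> (nat \<Rightarrow> real) \<Rightarrow> 'w \<Rightarrow> 'h"
where
  "stochastic_sum Z F n p \<omega> = (\<Sum>i<n. blinfun_apply (F (p i)) (Z (p (Suc i)) \<omega> - Z (p i) \<omega>))"

(* Y is (a version of) the integral over [0,t] of the deterministic operator function F against Z:
   the limit in probability of the stochastic sums along all sequences of partitions of [0,t] whose
   mesh tends to 0. *)
definition has_stochastic_integral ::
  "'w measure \<Rightarrow> (real \<Rightarrow> 'w \<Rightarrow> 'h) \<Rightarrow> (real \<Rightarrow> 'h \<Rightarrow>\<^sub>L 'h::{banach, second_countable_topology}) \<Rightarrow>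
     real \<Rightarrow> ('w \<Rightarrow> 'h) \<Rightarrow> bool" where
  "has_stochastic_integral M Z F t Y \<longleftrightarrow>
     Y \<in> borel_measurable M \<and>
     (\<forall>N p. (\<forall>k::nat. partition_of t (N k) (p k)) \<longrightarrow>
        (\<forall>\<delta>>0. \<forall>\<^sub>F k in sequentially. \<forall>i<N k. p k (Suc i) - p k i < \<delta>) \<longrightarrow>
        (\<forall>\<epsilon>>0. (\<lambda>k. measure M {\<omega> \<in> space M. \<epsilon> < norm (stochastic_sum Z F (N k) (p k) \<omega> - Y \<omega>)})
           \<longlonglongrightarrow> 0))"

(* X is the cadlag version on [0,T], as a random element of D([0,T];H), of the process
   t |-> integral over [0,t] of S(t - s) dZ_s. *)
definition stochastic_convolution ::
  "'w measure \<Rightarrow> real \<Rightarrow> (real \<Rightarrow> 'h \<Rightarrow>\<^sub>L 'h) \<Rightarrow>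
     (real \<Rightarrow> 'w \<Rightarrow> 'h::{banach, second_countable_topology}) \<Rightarrow> ('w \<Rightarrow> real \<Rightarrow> 'h) \<Rightarrow> bool" where
  "stochastic_convolution M T S Z X \<longleftrightarrow>
     X \<in> M \<rightarrow>\<^sub>M skorokhod_space T \<and>
     (\<forall>t\<in>{0..T}. has_stochastic_integral M Z (\<lambda>s. S (t - s)) t (\<lambda>\<omega>. X \<omega> t))"

end

theory Submission
  imports Defs
begin

text \<open>Both convolutions carry the driving noise in their jumps. For a smoothing operator \<open>P\<close>, an
  iterated integral of the semigroup, summation by parts in the approximating stochastic sums shows
  that \<open>P X(t) - P Z(t)\<close> is Lipschitz continuous in \<open>t\<close>; hence \<open>P\<close> annihilates the difference of the
  jumps of \<open>X\<close> and \<open>Z\<close>, and letting \<open>P\<close> vary, the jumps of \<open>X\<close> are those of \<open>Z\<close>. This needs neither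
  adjoints nor stochastic Fubini. The same holds for \<open>X'\<close>. As \<open>Z\<close> is purely jump, there is one
  measurable map \<open>\<zeta>\<close> on paths, built from sums of large jumps, with \<open>\<zeta>(X) = Z = \<zeta>(X')\<close> almost
  surely. Since \<open>X'(t)\<close> is a measurable functional of \<open>Z\<close>, it is a functional \<open>\<Psi>(X')\<close>, so the law of
  \<open>X'\<close> is concentrated on the paths \<open>f\<close> with \<open>\<Psi>(f) = f(t)\<close>; by absolute continuity so is the law
  of \<open>X\<close>. Hence \<open>X(t) = \<Psi>(X) = \<Psi>(X') = X'(t)\<close> almost surely.\<close>

subsection \<open>Semigroups and their smoothing operators\<close>

text \<open>The obstacle is that the semigroup is only strongly continuous: \<open>S (t - s)\<close>
  need not be close to the identity in operator norm for s near t, nor of bounded variation in s,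
  while the paths of \<open>Z\<close> may have infinite variation. Formally P X(t) - P Z(t) is the
  integral of P S(t - s) - P, a kernel that vanishes at s = t and so transmits no jump. Its
  increment from t to t' has the kernel P S(t' - s) - P S(t - s) on [0,t]; summation by parts needs
  both the size of this kernel and its variation in s to be of order t' - t. The variation is a
  second difference, which is why P consists of two smoothings. Jumps alone determine
  \<open>Z\<close> because the compensator is deterministic, the same vector for every path. A
  stochastic integral, being a limit in probability, is not given path by path; along a fixed
  subsequence of partitions it becomes an almost sure limit of finite sums, in which only countably
  many times occur. The other null sets are likewise collected over countable families of times and
  smoothing parameters.\<close>

lemma uniform_boundedness:
  fixes f :: "nat \<Rightarrow> 'a::banach \<Rightarrow>\<^sub>L 'b::real_normed_vector"
  assumes "\<And>x. \<exists>C. \<forall>n. norm (f n x) \<le> C"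
  shows "\<exists>C. \<forall>n. norm (f n) \<le> C"
proof -
  define F where "F k = {x. \<forall>n. norm (f n x) \<le> real k}" for k :: nat
  have closedF: "closed (F k)" for k
  proof -
    have "F k = (\<Inter>n. {x. norm (f n x) \<le> real k})"
      by (auto simp: F_def)
    moreover have "closed {x. norm (f n x) \<le> real k}" for n
      by (intro closed_Collect_le continuous_intros)
    ultimately show ?thesis by auto
  qed
  have cover: "(\<Union>k. F k) = UNIV"
  proof -
    have "\<exists>k. x \<in> F k" for x
    proof -
      obtain C where "\<And>n. norm (f n x) \<le> C" using assms by blast
      moreover obtain k :: nat where "C \<le> real k" using real_arch_simple by blast
      ultimately have "\<forall>n. norm (f n x) \<le> real k" by (meson order_trans)
      then show ?thesis unfolding F_def by blast
    qed
    then show ?thesis by blast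
  qed
  have "\<exists>k. interior (F k) \<noteq> {}"
  proof (rule ccontr)
    assume "\<not> ?thesis"
    then have "(euclidean :: 'a topology) interior_of \<Union>(range F) = {}"
      by (intro Baire_category_alt)
         (auto simp: closedF completely_metrizable_space_euclidean interior_of_def interior_def)
    then show False using cover by simp
  qed
  then obtain k x0 where "x0 \<in> interior (F k)" by blast
  then obtain r where r: "r > 0" "cball x0 r \<subseteq> F k"
    by (meson mem_interior_cball)
  have "norm (f n) \<le> 2 * real k / r" for n
  proof (rule norm_blinfun_bound)
    show "0 \<le> 2 * real k / r" using r by simp
    fix x
    show "norm (f n x) \<le> 2 * real k / r * norm x"
    proof (cases "x = 0")
      case False
      \<comment> \<open>The ball around x0 lies in \<open>F k\<close>, so every vector of norm r is
        a difference of two points of \<open>F k\<close>; hence the bound 2 * k / r.\<close>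
      define y where "y = (r / norm x) *\<^sub>R x"
      have "x0 + y \<in> F k" "x0 \<in> F k"
        using r False by (auto simp: y_def dist_norm intro!: subsetD[OF r(2)])
      then have "norm (f n (x0 + y)) \<le> real k" "norm (f n x0) \<le> real k"
        by (auto simp: F_def)
      moreover have "f n y = f n (x0 + y) - f n x0" by (simp add: blinfun.add_right)
      ultimately have "norm (f n y) \<le> 2 * real k"
        by (smt (verit) norm_triangle_ineq4)
      moreover have "norm (f n y) = r / norm x * norm (f n x)"
        using r by (simp add: y_def blinfun.scaleR_right)
      ultimately show ?thesis using r False by (simp add: field_simps)
    qed simp
  qed
  then show ?thesis by blast
qed

text \<open>Strong continuity bounds one orbit at a time. If the norms were unbounded near 0, there
  would be times tending to 0 along which the norms diverge although every orbit converges, against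
  uniform boundedness.\<close>

lemma C0_semigroup_bounded_near_0:
  fixes S :: "real \<Rightarrow> 'h::banach \<Rightarrow>\<^sub>L 'h"
  assumes "C0_semigroup S"
  shows "\<exists>\<delta>>0. \<exists>C. \<forall>t\<in>{0..\<delta>}. norm (S t) \<le> C"
proof (rule ccontr)
  assume neg: "\<not> ?thesis"
  have "\<exists>t\<in>{0..1 / real (Suc n)}. norm (S t) > real n" for n
    using neg by (auto simp: not_le dest!: spec[of _ "1 / real (Suc n)"] spec[of _ "real n"])
  then obtain t where t: "\<And>n. t n \<in> {0..1 / real (Suc n)}" "\<And>n. norm (S (t n)) > real n"
    by metis
  have lim: "t \<longlonglongrightarrow> 0"
    by (rule tendsto_sandwich[of "\<lambda>_. 0", OF _ _ tendsto_const LIMSEQ_inverse_real_of_nat])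
       (use t(1) in \<open>auto simp: inverse_eq_divide\<close>)
  have "\<exists>C. \<forall>n. norm (S (t n) x) \<le> C" for x
  proof -
    have "((\<lambda>t. S t x) \<longlongrightarrow> x) (at_right 0)" "S 0 x = x"
      using assms by (auto simp: C0_semigroup_def)
    then have "((\<lambda>t. S t x) \<longlongrightarrow> S 0 x) (at 0 within {0..})"
      by (simp add: at_within_Ici_at_right)
    then have "(\<lambda>n. S (t n) x) \<longlonglongrightarrow> S 0 x"
      using t(1) lim by (intro continuous_within_tendsto_compose'[where f = "\<lambda>t. S t x"])
        (auto simp: continuous_within)
    then have "convergent (\<lambda>n. S (t n) x)"
      by (auto simp: convergent_def o_def)
    then have "Bseq (\<lambda>n. S (t n) x)" by (rule convergent_imp_Bseq)
    then show ?thesis by (auto simp: Bseq_def)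
  qed
  from uniform_boundedness[OF this] obtain C where "\<And>n. norm (S (t n)) \<le> C" by blast
  moreover obtain k :: nat where "C \<le> real k" using real_arch_simple by blast
  ultimately show False using t(2)[of k] by (smt (verit))
qed

lemma C0_semigroup_add:
  assumes "C0_semigroup S" "0 \<le> s" "0 \<le> t"
  shows "S (s + t) x = S s (S t x)"
  using assms by (simp add: C0_semigroup_def)

lemma C0_semigroup_bounded:
  fixes S :: "real \<Rightarrow> 'h::banach \<Rightarrow>\<^sub>L 'h"
  assumes S: "C0_semigroup S"
  shows "\<exists>M\<ge>0. \<forall>t\<in>{0..a}. norm (S t) \<le> M"
proof -
  obtain \<delta> C where \<delta>: "\<delta> > 0" "\<And>t. t \<in> {0..\<delta>} \<Longrightarrow> norm (S t) \<le> C"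
    using C0_semigroup_bounded_near_0[OF S] by blast
  have C0: "0 \<le> C" using \<delta>(2)[of 0] \<delta>(1) by (auto intro: order_trans[OF norm_ge_zero])
  have "\<exists>M\<ge>0. \<forall>t\<in>{0..real n * \<delta>}. norm (S t) \<le> M" for n
  proof (induction n)
    case 0
    then show ?case using \<delta> C0 by auto
  next
    case (Suc n)
    then obtain M where M: "M \<ge> 0" "\<And>t. t \<in> {0..real n * \<delta>} \<Longrightarrow> norm (S t) \<le> M" by blast
    \<comment> \<open>One more step of length \<delta> multiplies the bound by C; the summand C
      covers times up to \<delta>, so one constant serves both cases.\<close>
    have "norm (S t) \<le> C + C * M" if "t \<in> {0..real (Suc n) * \<delta>}" for t
    proof (cases "t \<le> \<delta>")
      case True
      then show ?thesis using that \<delta>(2)[of t] C0 M(1) by (auto intro: order_trans)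
    next
      case False
      then have t: "t - \<delta> \<in> {0..real n * \<delta>}" using that by (auto simp: algebra_simps)
      then have "S (\<delta> + (t - \<delta>)) = S \<delta> o\<^sub>L S (t - \<delta>)"
        using S \<delta>(1) unfolding C0_semigroup_def by (metis atLeastAtMost_iff less_imp_le)
      then have "norm (S t) \<le> norm (S \<delta>) * norm (S (t - \<delta>))"
        by (simp add: norm_blinfun_compose)
      also have "\<dots> \<le> C * M"
        using M(2)[OF t] \<delta> C0 by (intro mult_mono) auto
      finally show ?thesis using C0 by simp
    qed
    moreover have "0 \<le> C + C * M" using C0 M(1) by simp
    ultimately show ?case by blast
  qed
  moreover obtain n :: nat where "a < real n * \<delta>" using ex_less_of_nat_mult[OF \<delta>(1)] by blast
  ultimately show ?thesis
    by (smt (verit, best) atLeastAtMost_iff)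
qed

lemma C0_semigroup_continuous_on:
  fixes S :: "real \<Rightarrow> 'h::banach \<Rightarrow>\<^sub>L 'h"
  assumes S: "C0_semigroup S"
  shows "continuous_on {0..a} (\<lambda>t. S t x)"
proof -
  obtain M where M: "M \<ge> 0" "\<And>t. t \<in> {0..a} \<Longrightarrow> norm (S t) \<le> M"
    using C0_semigroup_bounded[OF S] by blast
  have lim: "((\<lambda>t. S t x) \<longlongrightarrow> x) (at_right 0)" and S0: "S 0 x = x"
    using S by (auto simp: C0_semigroup_def)
  \<comment> \<open>Factoring out \<open>S\<close> at the smaller time turns left and right
    continuity alike into the limit at 0. From the left the smaller time varies, and there the
    uniform bound M is essential.\<close>
  have step: "dist (S t x) (S s x) \<le> M * norm (S (t - s) x - x)" if "0 \<le> s" "s \<le> t" "t \<le> a" for s t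
  proof -
    have "S t x - S s x = S s (S (t - s) x - x)"
      using C0_semigroup_add[OF S, of s "t - s" x] that by (simp add: blinfun.diff_right)
    then have "dist (S t x) (S s x) \<le> norm (S s) * norm (S (t - s) x - x)"
      by (simp add: dist_norm norm_blinfun)
    also have "\<dots> \<le> M * norm (S (t - s) x - x)"
      using M(2)[of s] that by (intro mult_right_mono) auto
    finally show ?thesis .
  qed
  show ?thesis
    unfolding continuous_on_iff
  proof (intro ballI allI impI)
    fix t e :: real assume t: "t \<in> {0..a}" and e: "e > 0"
    have "\<forall>\<^sub>F r in at_right 0. dist (S r x) x < e / (M + 1)"
      using lim e M(1) by (intro tendstoD) auto
    then obtain d where d: "d > 0" "\<And>r. 0 < r \<Longrightarrow> r < d \<Longrightarrow> dist (S r x) x < e / (M + 1)"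
      by (auto simp: eventually_at_right_field)
    have small: "M * norm (S r x - x) < e" if "0 \<le> r" "r < d" for r
    proof (cases "r = 0")
      case True
      then show ?thesis using e S0 by simp
    next
      case False
      then have "M * norm (S r x - x) \<le> M * (e / (M + 1))"
        using d(2)[of r] that M(1) by (intro mult_left_mono) (auto simp: dist_norm)
      also have "\<dots> < e" using e M(1) by (simp add: field_simps)
      finally show ?thesis .
    qed
    show "\<exists>d>0. \<forall>s\<in>{0..a}. dist s t < d \<longrightarrow> dist (S s x) (S t x) < e"
    proof (intro exI[of _ d] conjI ballI impI d(1))
      fix s assume s: "s \<in> {0..a}" "dist s t < d"
      show "dist (S s x) (S t x) < e"
      proof (cases "s \<le> t")
        case True
        then show ?thesis using step[of s t] small[of "t - s"] s t by (auto simp: dist_commute dist_real_def)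
      next
        case False
        then show ?thesis using step[of t s] small[of "s - t"] s t by (auto simp: dist_commute dist_real_def)
      qed
    qed
  qed
qed

section \<open>Time averages of orbits\<close>

text \<open>An unnormalised time average of the orbit, in the role of a resolvent: it commutes with
  the semigroup, takes values in the domain of the generator, and after division by h tends to x as
  h tends to 0.\<close>

definition smoothing :: "(real \<Rightarrow> 'h \<Rightarrow>\<^sub>L 'h) \<Rightarrow> real \<Rightarrow> 'h \<Rightarrow> 'h::banach" where
  "smoothing S h x = integral {0..h} (\<lambda>r. S r x)"

lemma C0_semigroup_integrable:
  fixes S :: "real \<Rightarrow> 'h::banach \<Rightarrow>\<^sub>L 'h"
  assumes S: "C0_semigroup S" "0 \<le> a"
  shows "(\<lambda>t. S t x) integrable_on {a..b}"
  using continuous_on_subset[OF C0_semigroup_continuous_on[OF S(1), of b]] \<open>0 \<le> a\<close>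
  by (intro integrable_continuous_interval) auto

lemma smoothing_semigroup:
  fixes S :: "real \<Rightarrow> 'h::banach \<Rightarrow>\<^sub>L 'h"
  assumes S: "C0_semigroup S" and "0 \<le> u"
  shows "smoothing S h (S u x) = integral {u..u + h} (\<lambda>r. S r x)"
    and "smoothing S h (S u x) = S u (smoothing S h x)"
proof -
  have "smoothing S h (S u x) = integral {0..h} ((\<lambda>r. S r x) \<circ> (+) u)"
    unfolding smoothing_def
    using C0_semigroup_add[OF S \<open>0 \<le> u\<close>] C0_semigroup_add[OF S _ \<open>0 \<le> u\<close>]
    by (intro integral_cong) (auto simp: add.commute)
  then show "smoothing S h (S u x) = integral {u..u + h} (\<lambda>r. S r x)"
    by (simp add: integral_shift_Icc_real add.commute)
  have "smoothing S h (S u x) = integral {0..h} (blinfun_apply (S u) \<circ> (\<lambda>r. S r x))"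
    unfolding smoothing_def
    using C0_semigroup_add[OF S \<open>0 \<le> u\<close>] C0_semigroup_add[OF S _ \<open>0 \<le> u\<close>]
    by (intro integral_cong) (metis add.commute atLeastAtMost_iff comp_apply)
  also have "\<dots> = S u (smoothing S h x)"
    unfolding smoothing_def
    by (intro integral_linear C0_semigroup_integrable S blinfun.bounded_linear_right) simp
  finally show "smoothing S h (S u x) = S u (smoothing S h x)" .
qed

lemma smoothing_add:
  fixes S :: "real \<Rightarrow> 'h::banach \<Rightarrow>\<^sub>L 'h"
  assumes S: "C0_semigroup S"
  shows "smoothing S h (x + y) = smoothing S h x + smoothing S h y"
  by (simp add: smoothing_def blinfun.add_right integral_add C0_semigroup_integrable[OF S])

lemma smoothing_scaleR: "smoothing S h (c *\<^sub>R x) = c *\<^sub>R smoothing S h x"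
  by (simp add: smoothing_def blinfun.scaleR_right)

lemma bounded_linear_smoothing:
  fixes S :: "real \<Rightarrow> 'h::banach \<Rightarrow>\<^sub>L 'h"
  assumes S: "C0_semigroup S" and "0 \<le> h"
  shows "bounded_linear (smoothing S h)"
proof -
  obtain M where M: "M \<ge> 0" "\<And>t. t \<in> {0..h} \<Longrightarrow> norm (S t) \<le> M"
    using C0_semigroup_bounded[OF S] by blast
  have "norm (smoothing S h x) \<le> norm x * (M * h)" for x
  proof -
    have "norm (smoothing S h x) \<le> (M * norm x) * (h - 0)"
      unfolding smoothing_def
      by (intro integral_bound assms C0_semigroup_continuous_on)
         (auto intro!: order_trans[OF norm_blinfun] mult_right_mono M)
    then show ?thesis by (simp add: ac_simps)
  qed
  then show ?thesis
    by (intro bounded_linear_intro[where K = "M * h"] smoothing_add smoothing_scaleR S)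
qed

text \<open>The integrals over [d, h + d] and [0, h] differ by two pieces of length d, whatever the
  order of h and d. Smoothing serves to gain this factor d uniformly in x, whereas
  \<open>S d x - x\<close> is small only for each fixed x.\<close>

lemma norm_smoothing_diff_le:
  fixes S :: "real \<Rightarrow> 'h::banach \<Rightarrow>\<^sub>L 'h"
  assumes S: "C0_semigroup S" and "0 \<le> h" "0 \<le> d" "h + d \<le> a"
    and M: "\<And>t. t \<in> {0..a} \<Longrightarrow> norm (S t) \<le> M"
  shows "norm (smoothing S h (S d x - x)) \<le> 2 * M * d * norm x"
proof -
  let ?I = "\<lambda>s t. integral {s..t} (\<lambda>r. S r x)"
  have "smoothing S h (S d x - x) = smoothing S h (S d x) - smoothing S h x"
    using bounded_linear_smoothing[OF S \<open>0 \<le> h\<close>] by (simp add: linear_diff bounded_linear.linear)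
  also have "\<dots> = ?I d (h + d) - ?I 0 h"
    using smoothing_semigroup(1)[OF S \<open>0 \<le> d\<close>] by (simp add: smoothing_def add.commute)
  also have "?I d (h + d) - ?I 0 h = ?I h (h + d) - ?I 0 d"
  proof -
    have "?I 0 c + ?I c (h + d) = ?I 0 (h + d)" if "0 \<le> c" "c \<le> h + d" for c
      by (rule Henstock_Kurzweil_Integration.integral_combine[OF that C0_semigroup_integrable[OF S order.refl]])
    then have "?I c (h + d) = ?I 0 (h + d) - ?I 0 c" if "0 \<le> c" "c \<le> h + d" for c
      using that by (metis add_diff_cancel_left')
    from this[of d] this[of h] show ?thesis using assms(2,3) by simp
  qed
  also have "norm \<dots> \<le> M * norm x * (h + d - h) + M * norm x * (d - 0)"
  proof -
    have "norm (?I s t) \<le> M * norm x * (t - s)" if "0 \<le> s" "s \<le> t" "t \<le> a" for s t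
      using that continuous_on_subset[OF C0_semigroup_continuous_on[OF S, of t x]]
      by (intro integral_bound) (auto intro!: order_trans[OF norm_blinfun] mult_right_mono M)
    from this[of h "h + d"] this[of 0 d] show ?thesis
      using assms(2-4) by (intro order_trans[OF norm_triangle_ineq4] add_mono) auto
  qed
  finally show ?thesis by (simp add: algebra_simps)
qed

text \<open>For small h the integral of \<open>S r y - y\<close> over [0, h] has norm at most half
  of h * norm y, but it equals - h y when smoothing kills y. Restricting to h = 1 / (n + 1) later
  keeps the null sets countable.\<close>

lemma smoothing_eq_0_imp_eq_0:
  fixes S :: "real \<Rightarrow> 'h::banach \<Rightarrow>\<^sub>L 'h"
  assumes S: "C0_semigroup S" and z: "\<And>n. smoothing S (1 / real (Suc n)) y = 0"
  shows "y = 0"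
proof (rule ccontr)
  assume "y \<noteq> 0"
  then have "norm y / 2 > 0" by simp
  moreover have S0: "S 0 y = y" using S by (simp add: C0_semigroup_def)
  ultimately obtain d where d: "d > 0" "\<And>r. r \<in> {0..1} \<Longrightarrow> dist r 0 < d \<Longrightarrow> dist (S r y) y < norm y / 2"
    using C0_semigroup_continuous_on[OF S, of 1 y] unfolding continuous_on_iff
    by (metis atLeastAtMost_iff order.refl zero_le_one)
  obtain n where n: "1 / real (Suc n) < d" using nat_approx_posE[OF d(1)] by auto
  define h where "h = 1 / real (Suc n)"
  have h: "0 < h" "h \<le> 1" "h < d" using n by (auto simp: h_def)
  have "norm (integral {0..h} (\<lambda>r. S r y - y)) \<le> norm y / 2 * (h - 0)"
    using h d(2) by (intro integral_bound continuous_on_diff C0_semigroup_continuous_on[OF S])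
      (auto simp: dist_norm intro!: less_imp_le)
  moreover have "integral {0..h} (\<lambda>r. S r y - y) = integral {0..h} (\<lambda>r. S r y) - integral {0..h} (\<lambda>_. y)"
    by (rule Henstock_Kurzweil_Integration.integral_diff)
       (simp_all add: C0_semigroup_integrable[OF S] integrable_const_ivl)
  moreover have "integral {0..h} (\<lambda>r. S r y) = 0" using z[of n] by (simp add: smoothing_def h_def)
  ultimately show False using h \<open>y \<noteq> 0\<close> by simp
qed

text \<open>Smoothing twice makes the second difference bilinear in the two step sizes; a single smoothing
  only gives an operator function that is Lipschitz continuous.\<close>
lemma smoothing_smoothing_lipschitz:
  fixes S :: "real \<Rightarrow> 'h::banach \<Rightarrow>\<^sub>L 'h" and a :: real
  assumes S: "C0_semigroup S" and hk: "0 \<le> h" "0 \<le> k"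
  defines "P \<equiv> \<lambda>x. smoothing S h (smoothing S k x)"
  obtains L where "0 \<le> L"
    "\<And>u d x. 0 \<le> u \<Longrightarrow> 0 \<le> d \<Longrightarrow> u + d \<le> a \<Longrightarrow> norm (P (S (u + d) x) - P (S u x)) \<le> L * d * norm x"
    "\<And>u d v x. 0 \<le> u \<Longrightarrow> 0 \<le> d \<Longrightarrow> 0 \<le> v \<Longrightarrow> u + v + d \<le> a \<Longrightarrow>
       norm ((P (S (u + v + d) x) - P (S (u + v) x)) - (P (S (u + d) x) - P (S u x))) \<le> L * d * v * norm x"
proof -
  define b where "b = h + k + \<bar>a\<bar>"
  obtain M where M: "M \<ge> 0" "\<And>t. t \<in> {0..b} \<Longrightarrow> norm (S t) \<le> M"
    using C0_semigroup_bounded[OF S] by blast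
  have lin: "linear (smoothing S h)" "linear (smoothing S k)"
    using bounded_linear_smoothing[OF S] hk by (auto simp: bounded_linear.linear)
  obtain B where B: "B \<ge> 0" "\<And>x. norm (smoothing S k x) \<le> norm x * B"
    using bounded_linear.nonneg_bounded[OF bounded_linear_smoothing[OF S hk(2)]] by blast
  define D where "D d x = S d x - x" for d x
  have nS: "norm (S u x) \<le> M * norm x" if "0 \<le> u" "u \<le> a" for u x
    using that hk by (intro order_trans[OF norm_blinfun] mult_right_mono M) (auto simp: b_def)
  have nh: "norm (smoothing S h (D d x)) \<le> 2 * M * d * norm x"
   and nk: "norm (smoothing S k (D d x)) \<le> 2 * M * d * norm x" if "0 \<le> d" "d \<le> a" for d x
    unfolding D_def using that hk M by (auto intro!: norm_smoothing_diff_le[OF S, where a = b] simp: b_def)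
  have comm: "smoothing S k (D d x) = D d (smoothing S k x)" if "0 \<le> d" for d x
    using that by (simp add: D_def linear_diff[OF lin(2)] smoothing_semigroup(2)[OF S])
  have e1: "P (S (u + d) x) - P (S u x) = smoothing S h (D d (smoothing S k (S u x)))"
    if "0 \<le> u" "0 \<le> d" for u d x
    using that C0_semigroup_add[OF S, of d u x]
    by (simp add: P_def D_def linear_diff[OF lin(1)] smoothing_semigroup(2)[OF S] add.commute)
  have DS: "D v (S u x) = S (u + v) x - S u x" if "0 \<le> u" "0 \<le> v" for u v x
    using that C0_semigroup_add[OF S, of v u x] by (simp add: D_def add.commute)
  \<comment> \<open>The second difference is one first difference applied after another; commutation
    places one under each smoothing, and each contributes its own factor, d and v.\<close>
  have e2: "(P (S (u + v + d) x) - P (S (u + v) x)) - (P (S (u + d) x) - P (S u x))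
      = smoothing S h (D d (smoothing S k (D v (S u x))))"
    if "0 \<le> u" "0 \<le> d" "0 \<le> v" for u d v x
  proof -
    have "D d (y - z) = D d y - D d z" for y z by (simp add: D_def blinfun.diff_right)
    then show ?thesis
      using that by (simp add: e1 DS linear_diff[OF lin(1)] linear_diff[OF lin(2)])
  qed
  \<comment> \<open>The first summand bounds a first difference, where one smoothing gains d and the
    other costs its norm B; the second bounds a second difference. The sum serves both.\<close>
  define L where "L = 2 * M * B * M + 2 * M * (2 * M * M)"
  show thesis
  proof (rule that[of L])
    show "0 \<le> L" using M(1) B(1) by (simp add: L_def)
  next
    fix u d x assume *: "0 \<le> u" "0 \<le> d" "u + d \<le> a"
    have "norm (P (S (u + d) x) - P (S u x)) \<le> 2 * M * d * norm (smoothing S k (S u x))"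
      unfolding e1[OF *(1,2)] using * by (intro nh) auto
    also have "\<dots> \<le> 2 * M * d * ((M * norm x) * B)"
      using * M(1) B(1) nS[of u x] by (intro mult_left_mono order_trans[OF B(2)] mult_right_mono) auto
    also have "\<dots> = (2 * M * B * M) * (d * norm x)" by (simp add: ac_simps)
    also have "\<dots> \<le> L * (d * norm x)"
      using * M(1) B(1) by (intro mult_right_mono) (auto simp: L_def)
    finally show "norm (P (S (u + d) x) - P (S u x)) \<le> L * d * norm x" by (simp add: ac_simps)
  next
    fix u d v x assume *: "0 \<le> u" "0 \<le> d" "0 \<le> v" "u + v + d \<le> a"
    have "norm ((P (S (u + v + d) x) - P (S (u + v) x)) - (P (S (u + d) x) - P (S u x)))
        \<le> 2 * M * d * norm (smoothing S k (D v (S u x)))"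
      unfolding e2[OF *(1-3)] using * by (intro nh) auto
    also have "\<dots> \<le> 2 * M * d * (2 * M * v * (M * norm x))"
      using * M(1) nS[of u x] by (intro mult_left_mono order_trans[OF nk]) auto
    also have "\<dots> = (2 * M * (2 * M * M)) * (d * v * norm x)" by (simp add: ac_simps)
    also have "\<dots> \<le> L * (d * v * norm x)"
      using * M(1) B(1) by (intro mult_right_mono) (auto simp: L_def)
    finally show "norm ((P (S (u + v + d) x) - P (S (u + v) x)) - (P (S (u + d) x) - P (S u x)))
        \<le> L * d * v * norm x" by (simp add: ac_simps)
  qed
qed

subsection \<open>Summation by parts and convergence in probability\<close>

text \<open>Abel summation moves the differences from z, which is merely bounded, onto F. The two
  boundary terms give 2 * E, the variation of F gives L times the length p n - p m.\<close>

lemma norm_sum_diff_le: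
  fixes F :: "nat \<Rightarrow> 'a::real_normed_vector \<Rightarrow> 'b::real_normed_vector"
  assumes lin: "\<And>i. linear (F i)"
    and F: "\<And>i x. m \<le> i \<Longrightarrow> i < n \<Longrightarrow> norm (F i x) \<le> E * norm x"
    and dF: "\<And>i x. m \<le> i \<Longrightarrow> Suc i < n \<Longrightarrow> norm (F (Suc i) x - F i x) \<le> L * (p (Suc i) - p i) * norm x"
    and z: "\<And>i. i \<le> n \<Longrightarrow> norm (z i) \<le> V"
    and "0 \<le> L" "0 \<le> E" "m \<le> n" and p: "\<And>i. m \<le> i \<Longrightarrow> i < n \<Longrightarrow> p i \<le> p (Suc i)"
  shows "norm (\<Sum>i=m..<n. F i (z (Suc i) - z i)) \<le> (2 * E + L * (p n - p m)) * V"
proof -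
  have V: "0 \<le> V" using z[of 0] norm_ge_zero by (meson le0 order_trans)
  have "norm (\<Sum>i=m..<k. F i (z (Suc i) - z i)) \<le> (2 * E + L * (p k - p m)) * V" if mk: "m \<le> k" "k \<le> n" for k
  proof (cases "k = m")
    case True
    then show ?thesis using V \<open>0 \<le> E\<close> by simp
  next
    case False
    then obtain l where k: "k = Suc l" "m \<le> l" using mk(1) by (cases k) auto
    \<comment> \<open>The last boundary term carries \<open>F l\<close>, not
      \<open>F (Suc l)\<close>, so every operator that occurs has an index below n and obeys the
      bounds \<open>F\<close> and \<open>dF\<close>.\<close>
    have parts: "(\<Sum>i=m..<Suc l. F i (z (Suc i) - z i)) =
        F l (z (Suc l)) - F m (z m) - (\<Sum>i=m..<l. F (Suc i) (z (Suc i)) - F i (z (Suc i)))"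
      using \<open>m \<le> l\<close>
    proof (induction l rule: dec_induct)
      case base
      then show ?case by (simp add: linear_diff[OF lin])
    next
      case (step l)
      then show ?case by (simp add: linear_diff[OF lin])
    qed
    have bd: "norm (F i (z j)) \<le> E * V" if "m \<le> i" "i < n" "j \<le> n" for i j
      using that z[of j] \<open>0 \<le> E\<close> by (intro order_trans[OF F] mult_left_mono) auto
    have mono: "p m \<le> p j" if "m \<le> j" "j \<le> n" for j
      using that by (induction j rule: dec_induct) (use p in \<open>auto intro: order_trans\<close>)
    have "norm (\<Sum>i=m..<l. F (Suc i) (z (Suc i)) - F i (z (Suc i))) \<le> (\<Sum>i=m..<l. L * (p (Suc i) - p i) * V)"
    proof (rule sum_norm_le)
      fix i assume i: "i \<in> {m..<l}"
      then have i': "m \<le> i" "Suc i < n" "Suc i \<le> n" using mk k by auto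
      have "norm (F (Suc i) (z (Suc i)) - F i (z (Suc i))) \<le> L * (p (Suc i) - p i) * norm (z (Suc i))"
        by (rule dF[OF i'(1,2)])
      also have "\<dots> \<le> L * (p (Suc i) - p i) * V"
        using z[OF i'(3)] p[of i] i' \<open>0 \<le> L\<close> by (intro mult_left_mono) auto
      finally show "norm (F (Suc i) (z (Suc i)) - F i (z (Suc i))) \<le> L * (p (Suc i) - p i) * V" .
    qed
    also have "\<dots> = L * (\<Sum>i=m..<l. p (Suc i) - p i) * V"
      by (simp add: sum_distrib_left sum_distrib_right)
    also have "\<dots> = L * (p l - p m) * V"
      by (simp add: sum_Suc_diff'[OF \<open>m \<le> l\<close>])
    also have "\<dots> \<le> L * (p k - p m) * V"
      using p[of l] mk k V \<open>0 \<le> L\<close> by (intro mult_right_mono mult_left_mono) auto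
    finally have s: "norm (\<Sum>i=m..<l. F (Suc i) (z (Suc i)) - F i (z (Suc i))) \<le> L * (p k - p m) * V" .
    have "norm (\<Sum>i=m..<k. F i (z (Suc i) - z i)) \<le> (E * V + E * V) + L * (p k - p m) * V"
      unfolding k(1) parts
      using mk k s by (intro order_trans[OF norm_triangle_ineq4] add_mono bd) auto
    then show ?thesis by (simp add: algebra_simps)
  qed
  from this[of n] show ?thesis using \<open>m \<le> n\<close> by simp
qed

text \<open>Truncating the norm at 1 turns convergence in probability into L1 convergence, which has
  almost surely convergent subsequences; once the truncated norm is below 1 it is the norm
  itself.\<close>

lemma (in prob_space) AE_subseq_of_tendsto_in_probability:
  fixes u :: "nat \<Rightarrow> 'a \<Rightarrow> 'b::{real_normed_vector, second_countable_topology}"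
  assumes [measurable]: "\<And>n. u n \<in> borel_measurable M"
    and lim: "\<And>\<epsilon>. \<epsilon> > 0 \<Longrightarrow> (\<lambda>n. measure M {\<omega> \<in> space M. \<epsilon> < norm (u n \<omega>)}) \<longlonglongrightarrow> 0"
  shows "\<exists>r::nat \<Rightarrow> nat. strict_mono r \<and> (AE \<omega> in M. (\<lambda>n. u (r n) \<omega>) \<longlonglongrightarrow> 0)"
proof -
  define v where "v n \<omega> = min 1 (norm (u n \<omega>))" for n \<omega>
  have [measurable]: "v n \<in> borel_measurable M" for n unfolding v_def by measurable
  have int: "integrable M (v n)" for n
    by (rule integrable_const_bound[where B = 1]) (auto simp: v_def)
  have "(\<lambda>n. \<integral>\<omega>. norm (v n \<omega>) \<partial>M) \<longlonglongrightarrow> 0"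
  proof (rule LIMSEQ_I)
    fix e :: real assume e: "e > 0"
    have "\<forall>\<^sub>F n in sequentially. measure M {\<omega> \<in> space M. e / 2 < norm (u n \<omega>)} < e / 2"
      using lim[of "e / 2"] e by (intro order_tendstoD(2)) auto
    then obtain N where N: "\<And>n. n \<ge> N \<Longrightarrow> measure M {\<omega> \<in> space M. e / 2 < norm (u n \<omega>)} < e / 2"
      by (auto simp: eventually_sequentially)
    have "(\<integral>\<omega>. norm (v n \<omega>) \<partial>M) < e" if "n \<ge> N" for n
    proof -
      let ?A = "{\<omega> \<in> space M. e / 2 < norm (u n \<omega>)}"
      have ind: "integrable M (indicator ?A :: _ \<Rightarrow> real)"
        by (rule integrable_real_indicator) (auto simp: emeasure_eq_measure)
      have "(\<integral>\<omega>. norm (v n \<omega>) \<partial>M) \<le> (\<integral>\<omega>. e / 2 + indicator ?A \<omega> \<partial>M)"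
      proof (rule integral_mono)
        show "integrable M (\<lambda>\<omega>. norm (v n \<omega>))" by (intro integrable_norm int)
      next
        show "integrable M (\<lambda>\<omega>. e / 2 + indicator ?A \<omega>)"
          by (intro Bochner_Integration.integrable_add integrable_const ind)
      qed (use e in \<open>auto simp: v_def indicator_def\<close>)
      also have "\<dots> = e / 2 + measure M ?A"
        using ind by (subst Bochner_Integration.integral_add) (auto simp: prob_space)
      also have "\<dots> < e" using N[OF that] by simp
      finally show ?thesis .
    qed
    moreover have "0 \<le> (\<integral>\<omega>. norm (v n \<omega>) \<partial>M)" for n by simp
    ultimately show "\<exists>N. \<forall>n\<ge>N. norm ((\<integral>\<omega>. norm (v n \<omega>) \<partial>M) - 0) < e"
      by (auto simp del: integral_nonneg_AE)
  qed
  from tendsto_L1_AE_subseq[OF int this] obtain r :: "nat \<Rightarrow> nat"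
    where r: "strict_mono r" "AE \<omega> in M. (\<lambda>n. v (r n) \<omega>) \<longlonglongrightarrow> 0" by blast
  have "(\<lambda>n. u (r n) \<omega>) \<longlonglongrightarrow> 0" if "(\<lambda>n. v (r n) \<omega>) \<longlonglongrightarrow> 0" for \<omega>
  proof (rule tendsto_norm_zero_cancel)
    have "\<forall>\<^sub>F n in sequentially. v (r n) \<omega> < 1" using that by (intro order_tendstoD) auto
    then have "\<forall>\<^sub>F n in sequentially. v (r n) \<omega> = norm (u (r n) \<omega>)"
      by eventually_elim (auto simp: v_def)
    then show "(\<lambda>n. norm (u (r n) \<omega>)) \<longlonglongrightarrow> 0" using that by (rule Lim_transform_eventually[rotated])
  qed
  then have "AE \<omega> in M. (\<lambda>n. u (r n) \<omega>) \<longlonglongrightarrow> 0" using r(2) by auto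
  then show ?thesis using r(1) by blast
qed

text \<open>Chebyshev's inequality; with the nonnegative integral, individual second moments may be
  infinite.\<close>

lemma (in prob_space) tendsto_in_probability_of_nn_integral_square:
  fixes u :: "nat \<Rightarrow> 'a \<Rightarrow> 'b::{real_normed_vector, second_countable_topology}"
  assumes [measurable]: "\<And>n. u n \<in> borel_measurable M"
    and lim: "(\<lambda>n. \<integral>\<^sup>+\<omega>. ennreal ((norm (u n \<omega>))\<^sup>2) \<partial>M) \<longlonglongrightarrow> 0"
    and e: "\<epsilon> > 0"
  shows "(\<lambda>n. measure M {\<omega> \<in> space M. \<epsilon> < norm (u n \<omega>)}) \<longlonglongrightarrow> 0"
proof -
  let ?I = "\<lambda>n. \<integral>\<^sup>+\<omega>. ennreal ((norm (u n \<omega>))\<^sup>2) \<partial>M"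
  have "emeasure M {\<omega> \<in> space M. \<epsilon> < norm (u n \<omega>)} \<le> ennreal (1 / \<epsilon>\<^sup>2) * ?I n" for n
  proof -
    have "1 \<le> ennreal (1 / \<epsilon>\<^sup>2) * ennreal ((norm (u n \<omega>))\<^sup>2)" if "\<epsilon> < norm (u n \<omega>)" for \<omega>
    proof -
      have "\<epsilon>\<^sup>2 \<le> (norm (u n \<omega>))\<^sup>2" using that e by (intro power_mono) auto
      then have "1 \<le> 1 / \<epsilon>\<^sup>2 * (norm (u n \<omega>))\<^sup>2" using e by (simp add: field_simps)
      then have "ennreal 1 \<le> ennreal (1 / \<epsilon>\<^sup>2 * (norm (u n \<omega>))\<^sup>2)" by (rule ennreal_leI)
      then show ?thesis by (simp only: ennreal_mult'' zero_le_power2 ennreal_1)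
    qed
    then have "emeasure M {\<omega> \<in> space M. \<epsilon> < norm (u n \<omega>)} \<le>
        emeasure M {\<omega> \<in> space M. 1 \<le> ennreal (1 / \<epsilon>\<^sup>2) * ennreal ((norm (u n \<omega>))\<^sup>2)}"
      by (intro emeasure_mono) auto
    also have "\<dots> \<le> ennreal (1 / \<epsilon>\<^sup>2) * (\<integral>\<^sup>+\<omega>. ennreal ((norm (u n \<omega>))\<^sup>2) * indicator (space M) \<omega> \<partial>M)"
      by (rule nn_integral_Markov_inequality) auto
    also have "(\<integral>\<^sup>+\<omega>. ennreal ((norm (u n \<omega>))\<^sup>2) * indicator (space M) \<omega> \<partial>M) = ?I n"
      by (intro nn_integral_cong) auto
    finally show ?thesis .
  qed
  note le = this
  have lim': "(\<lambda>n. ennreal (1 / \<epsilon>\<^sup>2) * ?I n) \<longlonglongrightarrow> 0"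
    using ennreal_tendsto_cmult[OF _ lim, of "ennreal (1 / \<epsilon>\<^sup>2)"] by simp
  have "(\<lambda>n. emeasure M {\<omega> \<in> space M. \<epsilon> < norm (u n \<omega>)}) \<longlonglongrightarrow> 0"
    by (rule tendsto_sandwich[OF _ _ tendsto_const lim']) (use le in auto)
  then have "(\<lambda>n. ennreal (measure M {\<omega> \<in> space M. \<epsilon> < norm (u n \<omega>)})) \<longlonglongrightarrow> ennreal 0"
    by (simp add: emeasure_eq_measure)
  then show ?thesis
    by (rule tendsto_ennrealD) auto
qed

subsection \<open>Jumps of cadlag paths\<close>

lemma cadlag_on_subset:
  assumes "cadlag_on I f" "J \<subseteq> I"
  shows "cadlag_on J f"
proof -
  have "(f \<longlongrightarrow> l) (at t within J \<inter> X)" if "(f \<longlongrightarrow> l) (at t within I \<inter> X)" for t l X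
    using that assms(2) by (rule_tac tendsto_within_subset) auto
  then show ?thesis
    using assms unfolding cadlag_on_def by (meson subsetD)
qed

text \<open>\<open>jump\<close> rests on the choice operator \<open>Lim\<close>. For a cadlag path
  the left limit exists and can be written \<open>f s - jump f s\<close>, the form in which left
  limits appear from here on.\<close>

lemma cadlag_on_tendsto_left:
  fixes f :: "real \<Rightarrow> 'h::real_normed_vector"
  assumes "cadlag_on {0..a} f" "0 < s" "s \<le> a"
  shows "(f \<longlongrightarrow> f s - jump f s) (at_left s)"
proof -
  have "at s within {0..a} \<inter> {..<s} = at_left s"
    using assms(2,3) by (intro at_within_nhd[of _ "{0<..}"]) auto
  then obtain l where "(f \<longlongrightarrow> l) (at_left s)"
    using assms unfolding cadlag_on_def by (metis atLeastAtMost_iff less_imp_le)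
  then show ?thesis
    by (simp add: jump_def tendsto_Lim)
qed

lemma cadlag_on_tendsto_right:
  fixes f :: "real \<Rightarrow> 'h::topological_space"
  assumes "cadlag_on {0..a} f" "0 \<le> s" "s < a"
  shows "(f \<longlongrightarrow> f s) (at_right s)"
proof -
  have "at s within {0..a} \<inter> {s<..} = at_right s"
    using assms(2,3) by (intro at_within_nhd[of _ "{..<a}"]) auto
  then show ?thesis
    using assms unfolding cadlag_on_def by (metis atLeastAtMost_iff less_imp_le)
qed

text \<open>Both one-sided limits with a common radius, ready for compactness arguments; at each
  endpoint one of the two conditions is trivial.\<close>

lemma cadlag_on_local:
  fixes f :: "real \<Rightarrow> 'h::real_normed_vector"
  assumes f: "cadlag_on {0..a} f" and s: "s \<in> {0..a}" and e: "e > 0"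
  shows "\<exists>d>0. (\<forall>q\<in>{0..a}. s \<le> q \<and> q < s + d \<longrightarrow> norm (f q - f s) < e) \<and>
    (\<forall>q\<in>{0..a}. s - d < q \<and> q < s \<longrightarrow> norm (f q - (f s - jump f s)) < e)"
proof -
  have "\<exists>d>0. \<forall>q\<in>{0..a}. s \<le> q \<and> q < s + d \<longrightarrow> norm (f q - f s) < e"
  proof (cases "s < a")
    case True
    then have "\<forall>\<^sub>F q in at_right s. dist (f q) (f s) < e"
      using cadlag_on_tendsto_right[OF f] s e by (intro tendstoD) auto
    then obtain b where b: "b > s" "\<And>q. s < q \<Longrightarrow> q < b \<Longrightarrow> dist (f q) (f s) < e"
      by (auto simp: eventually_at_right_field)
    then show ?thesis
      using e by (intro exI[of _ "b - s"]) (force simp: dist_norm order.order_iff_strict)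
  next
    case False
    then show ?thesis using s e by (intro exI[of _ 1]) auto
  qed
  then obtain d1 where d1: "d1 > 0" "\<And>q. q \<in> {0..a} \<Longrightarrow> s \<le> q \<Longrightarrow> q < s + d1 \<Longrightarrow> norm (f q - f s) < e"
    by blast
  have "\<exists>d>0. \<forall>q\<in>{0..a}. s - d < q \<and> q < s \<longrightarrow> norm (f q - (f s - jump f s)) < e"
  proof (cases "0 < s")
    case True
    then have "\<forall>\<^sub>F q in at_left s. dist (f q) (f s - jump f s) < e"
      using cadlag_on_tendsto_left[OF f] s e by (intro tendstoD) auto
    then obtain b where b: "b < s" "\<And>q. b < q \<Longrightarrow> q < s \<Longrightarrow> dist (f q) (f s - jump f s) < e"
      by (auto simp: eventually_at_left_field)
    then show ?thesis
      using e by (intro exI[of _ "s - b"]) (force simp: dist_norm)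
  next
    case False
    then show ?thesis using s e by (intro exI[of _ 1]) auto
  qed
  then obtain d2 where d2: "d2 > 0" "\<And>q. q \<in> {0..a} \<Longrightarrow> s - d2 < q \<Longrightarrow> q < s \<Longrightarrow> norm (f q - (f s - jump f s)) < e"
    by blast
  show ?thesis
    by (rule exI[of _ "min d1 d2"]) (use d1 d2 in auto)
qed

lemma cadlag_on_bounded:
  fixes f :: "real \<Rightarrow> 'h::real_normed_vector"
  assumes f: "cadlag_on {0..a} f"
  shows "\<exists>V. \<forall>s\<in>{0..a}. norm (f s) \<le> V"
proof -
  obtain d where d: "\<And>s. s \<in> {0..a} \<Longrightarrow> d s > 0"
    "\<And>s q. s \<in> {0..a} \<Longrightarrow> q \<in> {0..a} \<Longrightarrow> s \<le> q \<Longrightarrow> q < s + d s \<Longrightarrow> norm (f q - f s) < 1"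
    "\<And>s q. s \<in> {0..a} \<Longrightarrow> q \<in> {0..a} \<Longrightarrow> s - d s < q \<Longrightarrow> q < s \<Longrightarrow> norm (f q - (f s - jump f s)) < 1"
    using cadlag_on_local[OF f _ zero_less_one] by metis
  obtain F where F: "F \<subseteq> {0..a}" "finite F" "{0..a} \<subseteq> (\<Union>s\<in>F. ball s (d s))"
    by (rule compactE_image[of "{0..a}" "{0..a}" "\<lambda>s. ball s (d s)"]) (use d(1) in auto)
  have "norm (f q) \<le> (\<Sum>s\<in>F. norm (f s) + norm (f s - jump f s) + 1)" if q: "q \<in> {0..a}" for q
  proof -
    obtain s where s: "s \<in> F" "q \<in> ball s (d s)" using F(3) q by blast
    then have sa: "s \<in> {0..a}" using F(1) by blast
    have "norm (f q) \<le> norm (f s) + norm (f s - jump f s) + 1"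
    proof (cases "s \<le> q")
      case True
      then have "norm (f q - f s) < 1" using d(2)[OF sa q] s by (auto simp: dist_real_def)
      then show ?thesis using norm_triangle_sub[of "f q" "f s"] norm_ge_zero[of "f s - jump f s"] by linarith
    next
      case False
      then have "norm (f q - (f s - jump f s)) < 1" using d(3)[OF sa q] s by (auto simp: dist_real_def)
      then show ?thesis using norm_triangle_sub[of "f q" "f s - jump f s"] norm_ge_zero[of "f s"] by linarith
    qed
    also have "\<dots> \<le> (\<Sum>s\<in>F. norm (f s) + norm (f s - jump f s) + 1)"
      using s F(2) by (intro member_le_sum) auto
    finally show ?thesis .
  qed
  then show ?thesis by blast
qed

text \<open>F consists of the centres of a finite cover by intervals on which the path stays near
  one value left of the centre and near another from the centre on; \<delta> is a Lebesgue number of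
  this cover. Two points of one interval that its centre does not separate are compared with the
  same value.\<close>

lemma cadlag_on_small_increments:
  fixes f :: "real \<Rightarrow> 'h::real_normed_vector"
  assumes f: "cadlag_on {0..a} f" and e: "e > 0"
  obtains F \<delta> where "finite F" "F \<subseteq> {0..a}" "\<delta> > 0"
    "\<And>p q. 0 \<le> p \<Longrightarrow> p \<le> q \<Longrightarrow> q \<le> a \<Longrightarrow> q - p < \<delta> \<Longrightarrow> {p<..q} \<inter> F = {} \<Longrightarrow> norm (f q - f p) < e"
proof -
  have e2: "e / 2 > 0" using e by simp
  obtain d where d: "\<And>s. s \<in> {0..a} \<Longrightarrow> d s > 0"
    "\<And>s q. s \<in> {0..a} \<Longrightarrow> q \<in> {0..a} \<Longrightarrow> s \<le> q \<Longrightarrow> q < s + d s \<Longrightarrow> norm (f q - f s) < e / 2"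
    "\<And>s q. s \<in> {0..a} \<Longrightarrow> q \<in> {0..a} \<Longrightarrow> s - d s < q \<Longrightarrow> q < s \<Longrightarrow> norm (f q - (f s - jump f s)) < e / 2"
    using cadlag_on_local[OF f _ e2] by metis
  obtain F where F: "F \<subseteq> {0..a}" "finite F" "{0..a} \<subseteq> (\<Union>s\<in>F. ball s (d s))"
    by (rule compactE_image[of "{0..a}" "{0..a}" "\<lambda>s. ball s (d s)"]) (use d(1) in auto)
  obtain \<delta> where \<delta>: "\<delta> > 0" "\<And>x. x \<in> {0..a} \<Longrightarrow> \<exists>G\<in>(\<lambda>s. ball s (d s)) ` F. ball x \<delta> \<subseteq> G"
    by (rule Heine_Borel_lemma[of "{0..a}" "(\<lambda>s. ball s (d s)) ` F"]) (use F(3) in auto)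
  show thesis
  proof (rule that[OF F(2,1) \<delta>(1)])
    fix p q assume pq: "0 \<le> p" "p \<le> q" "q \<le> a" "q - p < \<delta>" "{p<..q} \<inter> F = {}"
    obtain s where s: "s \<in> F" "ball p \<delta> \<subseteq> ball s (d s)" using \<delta>(2)[of p] pq by auto
    have "p \<in> ball p \<delta>" "q \<in> ball p \<delta>" using pq \<delta>(1) by (auto simp: dist_real_def)
    then have "p \<in> ball s (d s)" "q \<in> ball s (d s)" using s(2) by blast+
    then have b: "\<bar>s - p\<bar> < d s" "\<bar>s - q\<bar> < d s" by (auto simp: dist_real_def)
    have sa: "s \<in> {0..a}" using s F(1) by blast
    have pa: "p \<in> {0..a}" "q \<in> {0..a}" using pq by auto
    \<comment> \<open>The interval is open at p and closed at q: s = p is harmless by right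
      continuity, whereas s = q would leave p near the left limit and q near f s.\<close>
    have "s \<notin> {p<..q}" using pq(5) s(1) by blast
    then consider "s \<le> p" | "q < s" by fastforce
    then obtain y where "norm (f p - y) < e / 2" "norm (f q - y) < e / 2"
    proof cases
      case 1
      then show ?thesis using d(2)[OF sa pa(1)] d(2)[OF sa pa(2)] b pq by (intro that[of "f s"]) auto
    next
      case 2
      then show ?thesis
        using d(3)[OF sa pa(1)] d(3)[OF sa pa(2)] b pq by (intro that[of "f s - jump f s"]) auto
    qed
    then show "norm (f q - f p) < e"
      using norm_triangle_ineq4[of "f q - y" "f p - y"] by simp
  qed
qed

text \<open>Let p increase to s: a finite F that misses s also misses {p<..s} once p is close to
  s.\<close>

lemma jump_small_off_finite:
  fixes f :: "real \<Rightarrow> 'h::real_normed_vector"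
  assumes f: "cadlag_on {0..a} f" and "finite F" "\<delta> > 0"
    and small: "\<And>p q. 0 \<le> p \<Longrightarrow> p \<le> q \<Longrightarrow> q \<le> a \<Longrightarrow> q - p < \<delta> \<Longrightarrow> {p<..q} \<inter> F = {} \<Longrightarrow> norm (f q - f p) < e"
    and s: "0 < s" "s \<le> a" "s \<notin> F"
  shows "norm (jump f s) \<le> e"
proof -
  have "\<forall>\<^sub>F p in at_left s. \<forall>u\<in>F. u \<notin> {p<..s}"
    using \<open>finite F\<close>
  proof (rule eventually_ball_finite, intro ballI)
    fix u assume "u \<in> F"
    then have "u < s \<or> s < u" using s(3) by (cases u s rule: linorder_cases) auto
    then show "\<forall>\<^sub>F p in at_left s. u \<notin> {p<..s}"
    proof
      assume "u < s"
      then have "\<forall>\<^sub>F p in at_left s. p \<in> {u<..<s}" by (rule eventually_at_left_real)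
      then show ?thesis by eventually_elim auto
    qed auto
  qed
  moreover have "\<forall>\<^sub>F p in at_left s. p \<in> {max 0 (s - \<delta>)<..<s}"
    using s \<open>\<delta> > 0\<close> by (intro eventually_at_left_real) auto
  ultimately have ev: "\<forall>\<^sub>F p in at_left s. norm (f s - f p) \<le> e"
  proof eventually_elim
    case (elim p)
    then have "{p<..s} \<inter> F = {}" by blast
    moreover have "0 \<le> p" "p \<le> s" "s - p < \<delta>" using elim by auto
    ultimately show ?case using s(2)
      by (auto intro!: less_imp_le[OF small])
  qed
  have "((\<lambda>p. norm (f s - f p)) \<longlongrightarrow> norm (f s - (f s - jump f s))) (at_left s)"
    by (intro tendsto_intros cadlag_on_tendsto_left[OF f s(1,2)])
  from tendsto_upperbound[OF this ev] show ?thesis by simp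
qed

lemma uniform_partition_index:
  fixes s t :: real
  assumes "0 < s" "s \<le> t"
  shows "\<exists>i<Suc n. t * real i / real (Suc n) < s \<and> s \<le> t * real (Suc i) / real (Suc n)"
proof -
  \<comment> \<open>The wanted index is this ceiling minus one, because the cells are open on the
    left and closed on the right, like the intervals {p<..q} on which increments are
    controlled.\<close>
  define m where "m = nat \<lceil>s * real (Suc n) / t\<rceil>"
  have pos: "0 < s * real (Suc n) / t" using assms by simp
  have le: "s * real (Suc n) / t \<le> real (Suc n)"
    using assms mult_right_mono[OF assms(2), of "real (Suc n)"] by (simp add: pos_divide_le_eq ac_simps)
  have m: "real m = of_int \<lceil>s * real (Suc n) / t\<rceil>"
    using pos unfolding m_def by (subst of_nat_nat) auto
  have m1: "s * real (Suc n) / t \<le> real m" "real m < s * real (Suc n) / t + 1"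
    unfolding m by linarith+
  then have "0 < m" using pos by (cases m) auto
  then obtain i where i: "m = Suc i" by (cases m) auto
  have "real i < s * real (Suc n) / t" "s * real (Suc n) / t \<le> real (Suc i)" using m1 by (auto simp: i)
  moreover have "i < Suc n" using calculation(1) le by linarith
  ultimately show ?thesis
    using assms by (intro exI[of _ i]) (simp add: pos_less_divide_eq pos_divide_less_eq pos_divide_le_eq pos_le_divide_eq ac_simps)
qed

text \<open>As \<phi> ignores small increments, on a fine partition only cells that meet F
  contribute; eventually each contains at most one point of F, and its increment tends to the jump
  there. Points of F with a jump of norm below e add 0 to the limit.\<close>

lemma sum_increments_tendsto_sum_jumps:
  fixes f :: "real \<Rightarrow> 'h::real_normed_vector" and \<phi> :: "'h \<Rightarrow> 'b::real_normed_vector"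
  assumes f: "cadlag_on {0..t} f" and "t > 0" "e > 0"
    and F: "finite F" "\<delta> > 0"
    and small: "\<And>p q. 0 \<le> p \<Longrightarrow> p \<le> q \<Longrightarrow> q \<le> t \<Longrightarrow> q - p < \<delta> \<Longrightarrow> {p<..q} \<inter> F = {} \<Longrightarrow> norm (f q - f p) < e"
    and \<phi>: "continuous_on UNIV \<phi>" and \<phi>0: "\<And>x. norm x < e \<Longrightarrow> \<phi> x = 0"
  shows "(\<lambda>n. \<Sum>i<Suc n. \<phi> (f (t * real (Suc i) / real (Suc n)) - f (t * real i / real (Suc n))))
    \<longlonglongrightarrow> (\<Sum>s\<in>F \<inter> {0<..t}. \<phi> (jump f s))"
proof -
  define p where "p n i = t * real i / real (Suc n)" for n i
  define g where "g n i = \<phi> (f (p n (Suc i)) - f (p n i))" for n i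
  define G where "G = F \<inter> {0<..t}"
  have finG: "finite G" using F by (simp add: G_def)
  obtain idx where idx: "\<And>n s. s \<in> G \<Longrightarrow> idx n s < Suc n \<and> p n (idx n s) < s \<and> s \<le> p n (Suc (idx n s))"
  proof -
    have "\<forall>n. \<forall>s\<in>G. \<exists>i. i < Suc n \<and> p n i < s \<and> s \<le> p n (Suc i)"
      using uniform_partition_index[of _ t] by (auto simp: p_def G_def)
    then show ?thesis using that by metis
  qed
  have mesh: "p n (Suc i) - p n i = t / real (Suc n)" for n i
    by (simp add: p_def flip: diff_divide_distrib right_diff_distrib)
  have meshlim: "(\<lambda>n. t / real (Suc n)) \<longlonglongrightarrow> 0"
    using LIMSEQ_Suc[OF lim_const_over_n[of t]] by simp
  have p_le: "0 \<le> p n i" for n i using \<open>t > 0\<close> by (simp add: p_def)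
  have p_le': "p n i \<le> t" if "i \<le> Suc n" for n i
    using \<open>t > 0\<close> that by (simp add: p_def divide_simps mult_left_mono)
  have unique: "i = idx n s" if "s \<in> G" "p n i < s" "s \<le> p n (Suc i)" for n i s
  proof -
    have mono: "p n i \<le> p n j" if "i \<le> j" for i j
      using that \<open>t > 0\<close> by (simp add: p_def divide_right_mono)
    show ?thesis
      using that idx[OF that(1), of n] mono[of "Suc i" "idx n s"] mono[of "Suc (idx n s)" i]
      by (metis not_less_eq_eq nle_le order.strict_trans2 order_less_irrefl le_antisym)
  qed
  have ev1: "\<forall>\<^sub>F n in sequentially. t / real (Suc n) < \<delta>"
    using meshlim F(2) by (rule order_tendstoD)
  have ev2: "\<forall>\<^sub>F n in sequentially. \<forall>s\<in>G. \<forall>s'\<in>G. s \<noteq> s' \<longrightarrow> t / real (Suc n) < \<bar>s - s'\<bar>"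
  proof (intro eventually_ball_finite finG ballI)
    fix s s' assume "s \<in> G" "s' \<in> G"
    show "\<forall>\<^sub>F n in sequentially. s \<noteq> s' \<longrightarrow> t / real (Suc n) < \<bar>s - s'\<bar>"
    proof (cases "s = s'")
      case False
      then have "\<forall>\<^sub>F n in sequentially. t / real (Suc n) < \<bar>s - s'\<bar>"
        by (intro order_tendstoD[OF meshlim]) simp
      then show ?thesis by eventually_elim simp
    qed simp
  qed
  have eq: "\<forall>\<^sub>F n in sequentially. (\<Sum>s\<in>G. g n (idx n s)) = (\<Sum>i<Suc n. g n i)"
    using ev1 ev2
  proof eventually_elim
    case (elim n)
    have inj: "inj_on (idx n) G"
    proof (rule inj_onI, rule ccontr)
      fix s s' assume s: "s \<in> G" "s' \<in> G" "idx n s = idx n s'" "s \<noteq> s'"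
      then have "\<bar>s - s'\<bar> < p n (Suc (idx n s)) - p n (idx n s)"
        using idx[of s n] idx[of s' n] by (auto simp: abs_if)
      then show False using elim(2) s unfolding mesh by force
    qed
    have "g n i = 0" if "i \<in> {..<Suc n} - idx n ` G" for i
    proof -
      have "{p n i<..p n (Suc i)} \<inter> F = {}"
      proof (rule ccontr)
        assume "\<not> ?thesis"
        then obtain s where s: "s \<in> F" "p n i < s" "s \<le> p n (Suc i)" by auto
        then have "s \<in> G" using p_le[of n i] p_le'[of "Suc i" n] that by (auto simp: G_def)
        then show False using unique[OF _ s(2,3)] that by blast
      qed
      then have "norm (f (p n (Suc i)) - f (p n i)) < e"
        using elim(1) mesh[of n i] p_le p_le'[of "Suc i" n] that \<open>t > 0\<close>
        by (intro small) (auto simp: p_def divide_right_mono)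
      then show ?thesis by (simp add: g_def \<phi>0)
    qed
    then have "(\<Sum>i<Suc n. g n i) = (\<Sum>i\<in>idx n ` G. g n i)"
      using idx by (intro sum.mono_neutral_right) auto
    also have "\<dots> = (\<Sum>s\<in>G. g n (idx n s))" by (rule sum.reindex[OF inj, unfolded o_def])
    finally show ?case ..
  qed
  have lim: "(\<lambda>n. g n (idx n s)) \<longlonglongrightarrow> \<phi> (jump f s)" if s: "s \<in> G" for s
  proof -
    have s': "s \<in> {0..t}" "0 < s" "s \<le> t" using s by (auto simp: G_def)
    have close: "\<bar>p n (idx n s) - s\<bar> \<le> t / real (Suc n)" "\<bar>p n (Suc (idx n s)) - s\<bar> \<le> t / real (Suc n)" for n
      using idx[OF s, of n] mesh[of n "idx n s"] by auto
    \<comment> \<open>The right end of the cell is at least s, possibly equal, so right continuity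
      applies; the left end is strictly below s and yields the left limit.\<close>
    have 1: "(\<lambda>n. f (p n (Suc (idx n s)))) \<longlonglongrightarrow> f s" 
    proof (rule tendstoI)
      fix r :: real assume "r > 0"
      from cadlag_on_local[OF f s'(1) this] obtain d where d: "d > 0"
        "\<And>q. q \<in> {0..t} \<Longrightarrow> s \<le> q \<Longrightarrow> q < s + d \<Longrightarrow> norm (f q - f s) < r" by blast
      have "\<forall>\<^sub>F n in sequentially. t / real (Suc n) < d" using meshlim d(1) by (rule order_tendstoD)
      then show "\<forall>\<^sub>F n in sequentially. dist (f (p n (Suc (idx n s)))) (f s) < r"
      proof eventually_elim
        case (elim n)
        then show ?case unfolding dist_norm
          using idx[OF s, of n] p_le p_le'[of "Suc (idx n s)" n] close(2)[of n] by (intro d(2)) auto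
      qed
    qed
    have 2: "(\<lambda>n. f (p n (idx n s))) \<longlonglongrightarrow> f s - jump f s" 
    proof (rule tendstoI)
      fix r :: real assume "r > 0"
      from cadlag_on_local[OF f s'(1) this] obtain d where d: "d > 0"
        "\<And>q. q \<in> {0..t} \<Longrightarrow> s - d < q \<Longrightarrow> q < s \<Longrightarrow> norm (f q - (f s - jump f s)) < r" by blast
      have "\<forall>\<^sub>F n in sequentially. t / real (Suc n) < d" using meshlim d(1) by (rule order_tendstoD)
      then show "\<forall>\<^sub>F n in sequentially. dist (f (p n (idx n s))) (f s - jump f s) < r"
      proof eventually_elim
        case (elim n)
        then show ?case unfolding dist_norm
          using idx[OF s, of n] p_le p_le'[of "idx n s" n] close(1)[of n] by (intro d(2)) auto
      qed
    qed
    have "(\<lambda>n. f (p n (Suc (idx n s))) - f (p n (idx n s))) \<longlonglongrightarrow> jump f s"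
      using tendsto_diff[OF 1 2] by simp
    moreover have "isCont \<phi> (jump f s)" using \<phi> by (simp add: continuous_on_eq_continuous_at)
    ultimately show ?thesis unfolding g_def by (rule isCont_tendsto_compose[rotated])
  qed
  have "(\<lambda>n. \<Sum>s\<in>G. g n (idx n s)) \<longlonglongrightarrow> (\<Sum>s\<in>G. \<phi> (jump f s))"
    by (intro tendsto_sum lim)
  from Lim_transform_eventually[OF this eq] show ?thesis
    by (simp only: g_def p_def G_def)
qed

section \<open>Sums of large jumps as measurable functionals of the path\<close>

text \<open>A continuous substitute for x times the indicator of norm x \<ge> e. The summand 2 / e
  makes it vanish for norm x < e / 2 already at k = 0; growing k steepens the ramp, which ends at e
  so that vectors of norm exactly e are kept.\<close>

definition norm_cutoff :: "real \<Rightarrow> nat \<Rightarrow> 'h \<Rightarrow> 'h::real_normed_vector" where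
  "norm_cutoff e k x = max 0 (min 1 (1 - (real k + 2 / e) * (e - norm x))) *\<^sub>R x"

definition jump_sum_approx :: "real \<Rightarrow> real \<Rightarrow> nat \<Rightarrow> nat \<Rightarrow> (real \<Rightarrow> 'h) \<Rightarrow> 'h::real_normed_vector" where
  "jump_sum_approx e t k n f =
     (\<Sum>i<Suc n. norm_cutoff e k (f (t * real (Suc i) / real (Suc n)) - f (t * real i / real (Suc n))))"

text \<open>The inner limit refines the partition, the outer one sharpens the continuous cutoff; in this form
  the sum of the jumps of norm at least \<open>e\<close> is visibly a measurable functional of the path.\<close>
definition jump_sum_lim :: "real \<Rightarrow> real \<Rightarrow> (real \<Rightarrow> 'h) \<Rightarrow> 'h::real_normed_vector" where
  "jump_sum_lim e t f = lim (\<lambda>k. lim (\<lambda>n. jump_sum_approx e t k n f))"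

lemma norm_cutoff_eq_0:
  assumes "e > 0" "norm x < e / 2"
  shows "norm_cutoff e k x = 0"
proof -
  have "1 = 2 / e * (e / 2)" using assms by simp
  also have "\<dots> \<le> (real k + 2 / e) * (e - norm x)"
    using assms by (intro mult_mono) auto
  finally show ?thesis by (simp add: norm_cutoff_def)
qed

lemma continuous_on_norm_cutoff: "continuous_on A (norm_cutoff e k)"
proof -
  have "continuous_on A (\<lambda>x. max 0 (min 1 (1 - c * (e - norm x))) *\<^sub>R x)" for c :: real
    by (intro continuous_on_scaleR continuous_on_max continuous_on_min continuous_on_diff
        continuous_on_mult continuous_on_norm continuous_on_const continuous_on_id)
  then show ?thesis unfolding norm_cutoff_def .
qed

lemma norm_cutoff_tendsto:
  "(\<lambda>k. norm_cutoff e k x) \<longlonglongrightarrow> (if e \<le> norm x then x else 0)" if "e > 0"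
proof (cases "e \<le> norm x")
  case True
  have "norm_cutoff e k x = x" for k
    using True that by (simp add: norm_cutoff_def mult_nonneg_nonpos)
  then show ?thesis using True by simp
next
  case False
  then have d: "e - norm x > 0" by simp
  have "\<forall>\<^sub>F k in sequentially. norm_cutoff e k x = 0"
  proof -
    obtain K :: nat where K: "1 < real K * (e - norm x)" using ex_less_of_nat_mult[OF d] by blast
    have "norm_cutoff e k x = 0" if "k \<ge> K" for k
    proof -
      have "real K * (e - norm x) \<le> (real k + 2 / e) * (e - norm x)"
        using that d \<open>e > 0\<close> by (intro mult_right_mono) (auto simp: add_increasing2)
      then show ?thesis using K by (simp add: norm_cutoff_def)
    qed
    then show ?thesis by (auto simp: eventually_sequentially)
  qed
  then show ?thesis using False by (simp add: tendsto_eventually)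
qed

lemma jump_sum_lim_eq:
  fixes f :: "real \<Rightarrow> 'h::real_normed_vector"
  assumes f: "cadlag_on {0..t} f" and "t \<ge> 0" "e > 0"
  shows "jump_sum_lim e t f = jump_sum f t {x. e \<le> norm x}"
    and "finite (jump_times f t {x. e \<le> norm x})"
proof -
  \<comment> \<open>Half the threshold lets one set F serve every k: all cutoffs vanish below e / 2,
    and jumps of norm at least e cannot lie off F.\<close>
  have "e / 2 > 0" using \<open>e > 0\<close> by simp
  from cadlag_on_small_increments[OF f this] obtain F \<delta> where F: "finite F" "F \<subseteq> {0..t}" "\<delta> > 0"
    "\<And>p q. 0 \<le> p \<Longrightarrow> p \<le> q \<Longrightarrow> q \<le> t \<Longrightarrow> q - p < \<delta> \<Longrightarrow> {p<..q} \<inter> F = {} \<Longrightarrow> norm (f q - f p) < e / 2"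
    by blast
  have sub: "jump_times f t {x. e \<le> norm x} = {s \<in> F \<inter> {0<..t}. e \<le> norm (jump f s)}"
  proof -
    have "s \<in> F" if "0 < s" "s \<le> t" "e \<le> norm (jump f s)" for s
      using jump_small_off_finite[OF f F(1,3,4) that(1,2)] \<open>e > 0\<close> that(3) by fastforce
    then show ?thesis unfolding jump_times_def by auto
  qed
  then show "finite (jump_times f t {x. e \<le> norm x})" using F(1) by simp
  have inner: "(\<lambda>n. jump_sum_approx e t k n f) \<longlonglongrightarrow> (\<Sum>s\<in>F \<inter> {0<..t}. norm_cutoff e k (jump f s))" for k
  proof (cases "t = 0")
    case True
    then show ?thesis using \<open>e > 0\<close> by (simp add: jump_sum_approx_def norm_cutoff_eq_0)
  next
    case False
    then show ?thesis
      unfolding jump_sum_approx_def using \<open>t \<ge> 0\<close> \<open>e > 0\<close>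
      by (intro sum_increments_tendsto_sum_jumps[OF f _ \<open>e / 2 > 0\<close> F(1,3,4)]
          continuous_on_norm_cutoff norm_cutoff_eq_0) auto
  qed
  have "(\<lambda>k. \<Sum>s\<in>F \<inter> {0<..t}. norm_cutoff e k (jump f s)) \<longlonglongrightarrow>
      (\<Sum>s\<in>F \<inter> {0<..t}. if e \<le> norm (jump f s) then jump f s else 0)"
    by (intro tendsto_sum norm_cutoff_tendsto \<open>e > 0\<close>)
  then show "jump_sum_lim e t f = jump_sum f t {x. e \<le> norm x}"
    unfolding jump_sum_lim_def limI[OF inner] jump_sum_def sub
    using F(1) by (intro limI) (simp add: sum.inter_filter del: Int_iff)
qed

text \<open>The general family g covers two uses: the paths of \<open>Z\<close> over
  \<open>M\<close>, and the coordinate evaluations of the path space, where the result is a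
  measurable functional of the path.\<close>

lemma borel_measurable_jump_sum_lim:
  fixes g :: "'w \<Rightarrow> real \<Rightarrow> 'h::{banach, second_countable_topology}"
  assumes g: "\<And>s. 0 \<le> s \<Longrightarrow> s \<le> t \<Longrightarrow> (\<lambda>\<omega>. g \<omega> s) \<in> borel_measurable N" and "t \<ge> 0"
  shows "(\<lambda>\<omega>. jump_sum_lim e t (g \<omega>)) \<in> borel_measurable N"
proof -
  have c: "norm_cutoff e k \<in> borel_measurable borel" for k
    by (intro borel_measurable_continuous_onI continuous_on_norm_cutoff)
  have [measurable]: "(\<lambda>\<omega>. g \<omega> (t * real i / real (Suc n))) \<in> borel_measurable N" if "i \<le> Suc n" for i n
    using that \<open>t \<ge> 0\<close> by (intro g) (auto simp: divide_simps mult_left_mono)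
  have [measurable]: "(\<lambda>\<omega>. jump_sum_approx e t k n (g \<omega>)) \<in> borel_measurable N" for k n
    unfolding jump_sum_approx_def
    by (intro borel_measurable_sum measurable_compose[OF _ c] borel_measurable_diff) (simp_all del: of_nat_Suc)
  show ?thesis unfolding jump_sum_lim_def by measurable
qed

lemma jump_sum_add_disjoint:
  assumes "finite (jump_times f t (B \<union> C))" "B \<inter> C = {}"
  shows "jump_sum f t B + jump_sum f t C = jump_sum f t (B \<union> C)"
proof -
  have "jump_times f t (B \<union> C) = jump_times f t B \<union> jump_times f t C"
    by (auto simp: jump_times_def)
  then show ?thesis
    unfolding jump_sum_def using assms
    by (simp add: sum.union_disjoint jump_times_def disjoint_iff)
qed

subsection \<open>Stochastic sums and the smoothed convolution\<close>

text \<open>Summation by parts makes this bound independent of the number of partition points.\<close>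
lemma smoothed_sum_increment:
  fixes S :: "real \<Rightarrow> 'h::banach \<Rightarrow>\<^sub>L 'h"
  assumes S: "C0_semigroup S" and hk: "0 \<le> h" "0 \<le> k"
  defines "P \<equiv> \<lambda>x. smoothing S h (smoothing S k x)"
  obtains C where "0 \<le> C"
    "\<And>N K p z V t t'. p 0 = 0 \<Longrightarrow> p N = t \<Longrightarrow> p K = t' \<Longrightarrow> N \<le> K \<Longrightarrow> (\<And>i. i < K \<Longrightarrow> p i \<le> p (Suc i)) \<Longrightarrow>
       t' \<le> T \<Longrightarrow> (\<And>s. s \<in> {0..T} \<Longrightarrow> norm (z s) \<le> V) \<Longrightarrow>
       norm ((P (\<Sum>i<K. S (t' - p i) (z (p (Suc i)) - z (p i))) - P (z t')) -
             (P (\<Sum>i<N. S (t - p i) (z (p (Suc i)) - z (p i))) - P (z t))) \<le> C * (t' - t) * V"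
proof -
  have linP: "linear P"
    unfolding P_def
    by (rule bounded_linear.linear[OF bounded_linear_compose[OF bounded_linear_smoothing[OF S hk(1)]
          bounded_linear_smoothing[OF S hk(2)]]])
  obtain L where L: "0 \<le> L"
    "\<And>u d x. 0 \<le> u \<Longrightarrow> 0 \<le> d \<Longrightarrow> u + d \<le> T \<Longrightarrow> norm (P (S (u + d) x) - P (S u x)) \<le> L * d * norm x"
    "\<And>u d v x. 0 \<le> u \<Longrightarrow> 0 \<le> d \<Longrightarrow> 0 \<le> v \<Longrightarrow> u + v + d \<le> T \<Longrightarrow>
       norm ((P (S (u + v + d) x) - P (S (u + v) x)) - (P (S (u + d) x) - P (S u x))) \<le> L * d * v * norm x"
    using smoothing_smoothing_lipschitz[OF S hk, of T] unfolding P_def by metis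
  show thesis
  \<comment> \<open>The increments before t account for 2 + \<bar>T\<bar>, those between t and t'
    for 3.\<close>
  proof (rule that[of "L * (5 + \<bar>T\<bar>)"])
    show "0 \<le> L * (5 + \<bar>T\<bar>)" using L(1) by simp
  next
    fix N K :: nat and p :: "nat \<Rightarrow> real" and z :: "real \<Rightarrow> 'h" and V t t' :: real
    assume p: "p 0 = 0" "p N = t" "p K = t'" "N \<le> K" "\<And>i. i < K \<Longrightarrow> p i \<le> p (Suc i)"
      and T: "t' \<le> T" and z: "\<And>s. s \<in> {0..T} \<Longrightarrow> norm (z s) \<le> V"
    define \<Delta> where "\<Delta> i = z (p (Suc i)) - z (p i)" for i
    have mono: "p i \<le> p j" if "i \<le> j" "j \<le> K" for i j
      using that by (induction j rule: dec_induct) (use p(5) in \<open>auto intro: order_trans\<close>)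
    have p0: "0 \<le> p i" "p i \<le> t'" if "i \<le> K" for i
      using mono[of 0 i] mono[of i K] that p by auto
    have tt: "0 \<le> t" "t \<le> t'" using p0[of N] p by auto
    have zp: "norm (z (p i)) \<le> V" if "i \<le> K" for i
      using p0[OF that] T by (intro z) auto
    have V: "0 \<le> V" using zp[of 0] by (meson le0 norm_ge_zero order_trans)
    \<comment> \<open>Writing z t' - z t as the sum of the increments after t leaves the coefficient
      F before t and G after t. F is of size t' - t because its two times differ by that much, G
      because it is Lipschitz and vanishes at t'.\<close>
    define F where "F i x = P (S (t' - p i) x) - P (S (t - p i) x)" for i x
    define G where "G i x = P (S (t' - p i) x) - P x" for i x
    have lin: "linear (F i)" "linear (G i)" for i
      unfolding F_def G_def
      by (auto intro!: linearI simp: blinfun.add_right blinfun.scaleR_right linear_add[OF linP] linear_scale[OF linP] scaleR_diff_right)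
    have split: "(\<Sum>i<K. f i) = (\<Sum>i<N. f i) + (\<Sum>i=N..<K. f i)" for f :: "nat \<Rightarrow> 'h"
      using sum.atLeastLessThan_concat[of 0 N K f] p(4) by (simp add: atLeast0LessThan)
    have zdiff: "z t' - z t = (\<Sum>i=N..<K. \<Delta> i)"
      unfolding \<Delta>_def using p by (simp add: sum_Suc_diff'[where f = "\<lambda>i. z (p i)"])
    have "(P (\<Sum>i<K. S (t' - p i) (\<Delta> i)) - P (z t')) - (P (\<Sum>i<N. S (t - p i) (\<Delta> i)) - P (z t))
      = (P (\<Sum>i<K. S (t' - p i) (\<Delta> i)) - P (\<Sum>i<N. S (t - p i) (\<Delta> i))) - P (z t' - z t)"
      by (simp add: linear_diff[OF linP])
    also have "\<dots> = (\<Sum>i=0..<N. F i (\<Delta> i)) + (\<Sum>i=N..<K. G i (\<Delta> i))"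
      unfolding zdiff split F_def G_def
      by (simp add: linear_add[OF linP] linear_sum[OF linP] sum_subtractf atLeast0LessThan)
    finally have eq: "(P (\<Sum>i<K. S (t' - p i) (\<Delta> i)) - P (z t')) - (P (\<Sum>i<N. S (t - p i) (\<Delta> i)) - P (z t))
      = (\<Sum>i=0..<N. F i (\<Delta> i)) + (\<Sum>i=N..<K. G i (\<Delta> i))" .
    have "norm (\<Sum>i=0..<N. F i (z (p (Suc i)) - z (p i))) \<le>
        (2 * (L * (t' - t)) + (L * (t' - t)) * (p N - p 0)) * V"
    proof (rule norm_sum_diff_le[OF lin(1)])
      fix i x assume i: "i < N"
      have pi: "0 \<le> p i" "p i \<le> t" using p0[of i] mono[of i N] i p by auto
      have "norm (P (S ((t - p i) + (t' - t)) x) - P (S (t - p i) x)) \<le> L * (t' - t) * norm x"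
        using tt pi T by (intro L(2)) auto
      then show "norm (F i x) \<le> L * (t' - t) * norm x" by (simp add: F_def)
    next
      fix i x assume i: "Suc i < N"
      have pi: "0 \<le> p i" "p i \<le> p (Suc i)" "p (Suc i) \<le> t"
        using p0[of i] mono[of "Suc i" N] i p by auto
      \<comment> \<open>The second difference with u = t - p (Suc i), v the cell length and d = t' -
        t: here the variation of F gets its factor t' - t.\<close>
      have "norm ((P (S ((t - p (Suc i)) + (p (Suc i) - p i) + (t' - t)) x) - P (S ((t - p (Suc i)) + (p (Suc i) - p i)) x))
          - (P (S ((t - p (Suc i)) + (t' - t)) x) - P (S (t - p (Suc i)) x)))
        \<le> L * (t' - t) * (p (Suc i) - p i) * norm x"
        using tt pi T by (intro L(3)) auto
      then show "norm (F (Suc i) x - F i x) \<le> L * (t' - t) * (p (Suc i) - p i) * norm x"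
        by (simp add: F_def norm_minus_commute)
    qed (use L(1) tt p zp in auto)
    also have "\<dots> \<le> (2 * (L * (t' - t)) + (L * (t' - t)) * \<bar>T\<bar>) * V"
      using p tt T V L(1) by (intro mult_right_mono add_left_mono mult_left_mono) auto
    finally have b1: "norm (\<Sum>i=0..<N. F i (\<Delta> i)) \<le> (2 * (L * (t' - t)) + (L * (t' - t)) * \<bar>T\<bar>) * V"
      unfolding \<Delta>_def .
    have S0: "S 0 x = x" for x using S by (simp add: C0_semigroup_def)
    have "norm (\<Sum>i=N..<K. G i (z (p (Suc i)) - z (p i))) \<le> (2 * (L * (t' - t)) + L * (p K - p N)) * V"
    proof (rule norm_sum_diff_le[OF lin(2)])
      fix i x assume i: "N \<le> i" "i < K"
      have pi: "t \<le> p i" "p i \<le> t'" using p0[of i] mono[of N i] i p by auto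
      have "norm (P (S (0 + (t' - p i)) x) - P (S 0 x)) \<le> L * (t' - p i) * norm x"
        using tt pi T by (intro L(2)) auto
      also have "\<dots> \<le> L * (t' - t) * norm x" using pi L(1) by (intro mult_right_mono mult_left_mono) auto
      finally show "norm (G i x) \<le> L * (t' - t) * norm x" by (simp add: G_def S0)
    next
      fix i x assume i: "N \<le> i" "Suc i < K"
      have pi: "0 \<le> p i" "p i \<le> p (Suc i)" "p (Suc i) \<le> t'"
        using p0[of i] mono[of "Suc i" K] i p by auto
      have "norm (P (S ((t' - p (Suc i)) + (p (Suc i) - p i)) x) - P (S (t' - p (Suc i)) x))
        \<le> L * (p (Suc i) - p i) * norm x"
        using pi T by (intro L(2)) auto
      then show "norm (G (Suc i) x - G i x) \<le> L * (p (Suc i) - p i) * norm x"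
        by (simp add: G_def norm_minus_commute)
    qed (use L(1) tt p zp in auto)
    also have "\<dots> = 3 * (L * (t' - t)) * V" using p by (simp add: algebra_simps)
    finally have b2: "norm (\<Sum>i=N..<K. G i (\<Delta> i)) \<le> 3 * (L * (t' - t)) * V"
      unfolding \<Delta>_def .
    show "norm ((P (\<Sum>i<K. S (t' - p i) (z (p (Suc i)) - z (p i))) - P (z t')) -
             (P (\<Sum>i<N. S (t - p i) (z (p (Suc i)) - z (p i))) - P (z t))) \<le> L * (5 + \<bar>T\<bar>) * (t' - t) * V"
      using order_trans[OF norm_triangle_ineq add_mono[OF b1 b2]] unfolding eq[unfolded \<Delta>_def] \<Delta>_def
      by (simp add: algebra_simps)
  qed
qed

section \<open>Stochastic integrals along sequences of partitions\<close>

lemma has_stochastic_integral_tendsto_in_probability: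
  assumes "has_stochastic_integral M Z F t Y" "\<And>k. partition_of t (N k) (p k)"
    and mesh: "\<And>k i. i < N k \<Longrightarrow> p k (Suc i) - p k i \<le> c k" "c \<longlonglongrightarrow> 0" and "\<epsilon> > 0"
  shows "(\<lambda>k. measure M {\<omega> \<in> space M. \<epsilon> < norm (stochastic_sum Z F (N k) (p k) \<omega> - Y \<omega>)}) \<longlonglongrightarrow> 0"
proof -
  have "\<forall>\<delta>>0. \<forall>\<^sub>F k in sequentially. \<forall>i<N k. p k (Suc i) - p k i < \<delta>"
  proof (intro allI impI)
    fix \<delta> :: real assume "\<delta> > 0"
    with mesh(2) have "\<forall>\<^sub>F k in sequentially. c k < \<delta>" by (rule order_tendstoD)
    then show "\<forall>\<^sub>F k in sequentially. \<forall>i<N k. p k (Suc i) - p k i < \<delta>"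
      by eventually_elim (use mesh(1) in \<open>auto intro: order.strict_trans1\<close>)
  qed
  then show ?thesis
    using assms(1,2,5) unfolding has_stochastic_integral_def by blast
qed

lemma partition_of_nonneg:
  assumes "partition_of t N p" "i \<le> N"
  shows "0 \<le> p i"
  using assms(2)
proof (induction i)
  case (Suc i)
  then have "p i < p (Suc i)" using assms(1) by (simp add: partition_of_def)
  then show ?case using Suc by simp
qed (use assms(1) in \<open>simp add: partition_of_def\<close>)

lemma partition_of_le:
  assumes "partition_of t N p" "i \<le> N"
  shows "p i \<le> t"
  using assms(2)
proof (induction i rule: inc_induct)
  case (step i)
  then have "p i < p (Suc i)" using assms(1) by (simp add: partition_of_def)
  then show ?case using step by simp
qed (use assms(1) in \<open>simp add: partition_of_def\<close>)

lemma borel_measurable_stochastic_sum: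
  fixes Z :: "real \<Rightarrow> 'w \<Rightarrow> 'h::{real_normed_vector, second_countable_topology}"
  assumes "partition_of t N p" "\<And>s. 0 \<le> s \<Longrightarrow> s \<le> t \<Longrightarrow> Z s \<in> borel_measurable M"
  shows "stochastic_sum Z F N p \<in> borel_measurable M"
proof -
  have Z: "Z (p i) \<in> borel_measurable M" if "i \<le> N" for i
    using partition_of_nonneg[OF assms(1) that] partition_of_le[OF assms(1) that] by (rule assms(2))
  have F: "blinfun_apply (F s) \<in> borel_measurable borel" for s
    by (intro borel_measurable_continuous_onI continuous_intros)
  show ?thesis
    unfolding stochastic_sum_def
    by (intro borel_measurable_sum measurable_compose[OF _ F] borel_measurable_diff Z) auto
qed

text \<open>Unlike a limit in probability, an almost sure limit along fixed partitions can be read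
  off from a single path of \<open>Z\<close>; it allows pathwise estimates and makes the integral a
  functional of the path.\<close>

lemma (in prob_space) has_stochastic_integral_AE_subseq:
  fixes Z :: "real \<Rightarrow> 'a \<Rightarrow> 'h::{banach, second_countable_topology}"
  assumes Y: "has_stochastic_integral M Z F t Y" and p: "\<And>k. partition_of t (N k) (p k)"
    and mesh: "\<And>k i. i < N k \<Longrightarrow> p k (Suc i) - p k i \<le> c k" "c \<longlonglongrightarrow> 0"
    and Z: "\<And>s. 0 \<le> s \<Longrightarrow> s \<le> t \<Longrightarrow> Z s \<in> borel_measurable M"
  shows "\<exists>r::nat \<Rightarrow> nat. strict_mono r \<and>
    (AE \<omega> in M. (\<lambda>k. stochastic_sum Z F (N (r k)) (p (r k)) \<omega>) \<longlonglongrightarrow> Y \<omega>)"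
proof -
  have [measurable]: "Y \<in> borel_measurable M" using Y by (simp add: has_stochastic_integral_def)
  have [measurable]: "stochastic_sum Z F (N k) (p k) \<in> borel_measurable M" for k
    by (rule borel_measurable_stochastic_sum[OF p Z])
  have "\<exists>r::nat \<Rightarrow> nat. strict_mono r \<and>
      (AE \<omega> in M. (\<lambda>k. stochastic_sum Z F (N (r k)) (p (r k)) \<omega> - Y \<omega>) \<longlonglongrightarrow> 0)"
    by (rule AE_subseq_of_tendsto_in_probability[of "\<lambda>k \<omega>. stochastic_sum Z F (N k) (p k) \<omega> - Y \<omega>"])
       (auto intro: has_stochastic_integral_tendsto_in_probability[OF Y p mesh])
  then show ?thesis by (simp add: LIM_zero_iff)
qed

lemma partition_of_uniform:
  assumes "t > 0"
  shows "partition_of t (Suc k) (\<lambda>i. t * real i / real (Suc k))"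
  unfolding partition_of_def
proof (intro conjI allI impI)
  fix i
  have "t * real i < t * real (Suc i)" using assms by simp
  then show "t * real i / real (Suc k) < t * real (Suc i) / real (Suc k)"
    by (rule divide_strict_right_mono) simp
qed simp_all

lemma uniform_mesh: "t * real (Suc i) / real (Suc k) - t * real i / real (Suc k) = t / real (Suc k)"
proof -
  have "t * real (Suc i) - t * real i = t" by (simp add: algebra_simps)
  then show ?thesis by (simp only: diff_divide_distrib[symmetric])
qed

lemma uniform_mesh_tendsto_0: "(\<lambda>k. t / real (Suc k)) \<longlonglongrightarrow> (0::real)"
  by (rule LIMSEQ_Suc[OF lim_const_over_n])

text \<open>The bound for sums passes to the limit because its constant is independent of the
  partition. V is quantified inside the almost sure statement because it will be a random bound on
  the path.\<close>

lemma (in prob_space) smoothed_convolution_lipschitz: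
  fixes Z :: "real \<Rightarrow> 'a \<Rightarrow> 'h::{banach, second_countable_topology}"
  assumes S: "C0_semigroup S" and hk: "0 \<le> h" "0 \<le> k"
    and Z: "\<And>s. 0 \<le> s \<Longrightarrow> Z s \<in> borel_measurable M"
    and X: "\<And>t. t \<in> {0..T} \<Longrightarrow> has_stochastic_integral M Z (\<lambda>s. S (t - s)) t (\<lambda>\<omega>. X \<omega> t)"
  defines "Y \<equiv> \<lambda>\<omega> t. smoothing S h (smoothing S k (X \<omega> t)) - smoothing S h (smoothing S k (Z t \<omega>))"
  obtains C where "0 \<le> C"
    "\<And>t t'. 0 < t \<Longrightarrow> t < t' \<Longrightarrow> t' \<le> T \<Longrightarrow>
       AE \<omega> in M. \<forall>V. (\<forall>s\<in>{0..T}. norm (Z s \<omega>) \<le> V) \<longrightarrow> norm (Y \<omega> t' - Y \<omega> t) \<le> C * (t' - t) * V"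
proof -
  define P where "P x = smoothing S h (smoothing S k x)" for x
  have contP: "isCont P x" for x
    unfolding P_def
    by (rule linear_continuous_at[OF bounded_linear_compose[OF bounded_linear_smoothing[OF S hk(1)]
          bounded_linear_smoothing[OF S hk(2)]]])
  show thesis
  proof (rule smoothed_sum_increment[OF S hk, where T = T, folded P_def])
    fix C assume C: "0 \<le> C"
    "\<And>N K p z V t t'. p 0 = 0 \<Longrightarrow> p N = t \<Longrightarrow> p K = t' \<Longrightarrow> N \<le> K \<Longrightarrow> (\<And>i. i < K \<Longrightarrow> p i \<le> p (Suc i)) \<Longrightarrow>
       t' \<le> T \<Longrightarrow> (\<And>s. s \<in> {0..T} \<Longrightarrow> norm (z s) \<le> V) \<Longrightarrow>
       norm ((P (\<Sum>i<K. S (t' - p i) (z (p (Suc i)) - z (p i))) - P (z t')) -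
             (P (\<Sum>i<N. S (t - p i) (z (p (Suc i)) - z (p i))) - P (z t))) \<le> C * (t' - t) * V"
    show thesis
    proof (rule that[OF C(1)])
      fix t t' assume t: "0 < t" "t < t'" "t' \<le> T"
      \<comment> \<open>A partition of [0,t'] whose first half is a partition of [0,t], so that the
        sums at t and at t' use the same points, as summation by parts requires.\<close>
      define p where "p n i = (if i \<le> Suc n then t * real i / real (Suc n)
          else t + (t' - t) * real (i - Suc n) / real (Suc n))" for n i
      have p_le: "p n i = t * real i / real (Suc n)" if "i \<le> Suc n" for n i
        using that by (simp add: p_def)
      have p_ge: "p n i = t + (t' - t) * real (i - Suc n) / real (Suc n)" if "Suc n \<le> i" for n i
        using that by (cases "i = Suc n") (auto simp: p_def)
      have step: "p n (Suc i) - p n i = (if i < Suc n then t else t' - t) / real (Suc n)" for n i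
      proof (cases "i < Suc n")
        case True
        then show ?thesis using uniform_mesh[of t i n] p_le[of i n] p_le[of "Suc i" n] by simp
      next
        case False
        then show ?thesis
          using uniform_mesh[of "t' - t" "i - Suc n" n] p_ge[of n i] p_ge[of n "Suc i"]
          by (simp add: Suc_diff_le not_less)
      qed
      have part: "partition_of t (Suc n) (p n)" "partition_of t' (2 * Suc n) (p n)" for n
      proof -
        have "p n i < p n (Suc i)" for i
        proof -
          have "0 < p n (Suc i) - p n i" unfolding step using t by simp
          then show ?thesis by simp
        qed
        moreover have "p n 0 = 0" "p n (Suc n) = t" by (simp_all add: p_def)
        moreover have "p n (2 * Suc n) = t'" using p_ge[of n "2 * Suc n"] by simp
        ultimately show "partition_of t (Suc n) (p n)" "partition_of t' (2 * Suc n) (p n)"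
          by (auto simp: partition_of_def)
      qed
      have mesh: "p n (Suc i) - p n i \<le> t' / real (Suc n)" for n i
        unfolding step using t by (intro divide_right_mono) auto
      have meshlim: "(\<lambda>n. t' / real (Suc n)) \<longlonglongrightarrow> 0" by (rule uniform_mesh_tendsto_0)
      have X1: "has_stochastic_integral M Z (\<lambda>s. S (t - s)) t (\<lambda>\<omega>. X \<omega> t)"
       and X2: "has_stochastic_integral M Z (\<lambda>s. S (t' - s)) t' (\<lambda>\<omega>. X \<omega> t')"
        using t by (auto intro: X)
      obtain r1 :: "nat \<Rightarrow> nat" where r1: "strict_mono r1"
        "AE \<omega> in M. (\<lambda>n. stochastic_sum Z (\<lambda>s. S (t - s)) (Suc (r1 n)) (p (r1 n)) \<omega>) \<longlonglongrightarrow> X \<omega> t"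
        using has_stochastic_integral_AE_subseq[OF X1 part(1) mesh meshlim Z] by blast
      \<comment> \<open>Extracted from the sequence along r1, so that both limits hold along r1
        \<circ> r2.\<close>
      obtain r2 :: "nat \<Rightarrow> nat" where r2: "strict_mono r2"
        "AE \<omega> in M. (\<lambda>n. stochastic_sum Z (\<lambda>s. S (t' - s)) (2 * Suc (r1 (r2 n))) (p (r1 (r2 n))) \<omega>) \<longlonglongrightarrow> X \<omega> t'"
        using has_stochastic_integral_AE_subseq[OF X2 part(2) mesh LIMSEQ_subseq_LIMSEQ[OF meshlim r1(1), unfolded o_def] Z]
        by blast
      show "AE \<omega> in M. \<forall>V. (\<forall>s\<in>{0..T}. norm (Z s \<omega>) \<le> V) \<longrightarrow> norm (Y \<omega> t' - Y \<omega> t) \<le> C * (t' - t) * V"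
        using r1(2) r2(2)
      proof eventually_elim
        case (elim \<omega>)
        show ?case
        proof (intro allI impI)
          fix V assume V: "\<forall>s\<in>{0..T}. norm (Z s \<omega>) \<le> V"
          define a where "a n = stochastic_sum Z (\<lambda>s. S (t - s)) (Suc (r1 (r2 n))) (p (r1 (r2 n))) \<omega>" for n
          define b where "b n = stochastic_sum Z (\<lambda>s. S (t' - s)) (2 * Suc (r1 (r2 n))) (p (r1 (r2 n))) \<omega>" for n
          have a: "a \<longlonglongrightarrow> X \<omega> t"
            using LIMSEQ_subseq_LIMSEQ[OF elim(1) r2(1)] by (simp add: a_def[abs_def] o_def)
          have b: "b \<longlonglongrightarrow> X \<omega> t'" using elim(2) by (simp add: b_def[abs_def])
          have "norm ((P (b n) - P (Z t' \<omega>)) - (P (a n) - P (Z t \<omega>))) \<le> C * (t' - t) * V" for n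
            unfolding a_def b_def stochastic_sum_def
            using part[of "r1 (r2 n)"] t V
            by (intro C(2)[of "p (r1 (r2 n))" "Suc (r1 (r2 n))" t "2 * Suc (r1 (r2 n))" t' "\<lambda>s. Z s \<omega>" V])
               (auto simp: partition_of_def intro: less_imp_le)
          moreover have "(\<lambda>n. norm ((P (b n) - P (Z t' \<omega>)) - (P (a n) - P (Z t \<omega>)))) \<longlonglongrightarrow> norm (Y \<omega> t' - Y \<omega> t)"
            unfolding Y_def P_def[symmetric]
            by (intro tendsto_intros isCont_tendsto_compose[OF contP] a b)
          ultimately show "norm (Y \<omega> t' - Y \<omega> t) \<le> C * (t' - t) * V"
            by (intro LIMSEQ_le_const2) auto
        qed
      qed
    qed
  qed
qed

subsection \<open>Recovering the driving process from a path\<close>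

text \<open>The countable set over which almost sure statements are combined. It contains T, which
  right limits within [0,T] do not reach, and leaves out 0, where partitions degenerate and right
  continuity takes over.\<close>

definition time_grid :: "real \<Rightarrow> real set" where
  "time_grid T = {q. 0 < q \<and> q \<le> T \<and> (q \<in> \<rat> \<or> q = T)}"

lemma countable_time_grid: "countable (time_grid T)"
  by (rule countable_subset[of _ "insert T \<rat>"]) (auto simp: time_grid_def countable_rat)

lemma time_grid_sequence_left:
  assumes "0 < s" "s \<le> T"
  shows "\<exists>q. (\<forall>n. q n \<in> time_grid T \<and> q n < s) \<and> filterlim q (at_left s) sequentially"
proof -
  have "\<exists>q. q \<in> \<rat> \<and> max 0 (s - 1 / real (Suc n)) < q \<and> q < s" for n
    using Rats_dense_in_real[of "max 0 (s - 1 / real (Suc n))" s] assms by (auto simp: field_simps)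
  then obtain q where q: "\<And>n. q n \<in> \<rat> \<and> max 0 (s - 1 / real (Suc n)) < q n \<and> q n < s"
    by metis
  have lim: "(\<lambda>n. s - 1 / real (Suc n)) \<longlonglongrightarrow> s"
    using tendsto_diff[OF tendsto_const uniform_mesh_tendsto_0[of 1], of s] by simp
  have "q \<longlonglongrightarrow> s"
    by (rule tendsto_sandwich[OF _ _ lim tendsto_const]) (use q in \<open>auto intro!: always_eventually less_imp_le\<close>)
  then have "filterlim q (at_left s) sequentially"
    using q by (intro tendsto_imp_filterlim_at_left) auto
  moreover have "\<forall>n. q n \<in> time_grid T \<and> q n < s"
  proof
    fix n
    show "q n \<in> time_grid T \<and> q n < s" using q[of n] assms by (simp add: time_grid_def)
  qed
  ultimately show ?thesis by blast
qed

lemma time_grid_sequence_right: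
  assumes "0 \<le> s" "s < T"
  shows "\<exists>q. (\<forall>n. q n \<in> time_grid T \<and> s < q n) \<and> filterlim q (at_right s) sequentially"
proof -
  have "\<exists>q. q \<in> \<rat> \<and> s < q \<and> q < min T (s + 1 / real (Suc n))" for n
    using Rats_dense_in_real[of s "min T (s + 1 / real (Suc n))"] assms by (auto simp: field_simps)
  then obtain q where q: "\<And>n. q n \<in> \<rat> \<and> s < q n \<and> q n < min T (s + 1 / real (Suc n))"
    by metis
  have lim: "(\<lambda>n. s + 1 / real (Suc n)) \<longlonglongrightarrow> s"
    using tendsto_add[OF tendsto_const uniform_mesh_tendsto_0[of 1], of s] by simp
  have "q \<longlonglongrightarrow> s"
    by (rule tendsto_sandwich[OF _ _ tendsto_const lim]) (use q in \<open>auto intro!: always_eventually less_imp_le\<close>)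
  then have "filterlim q (at_right s) sequentially"
    using q by (intro tendsto_imp_filterlim_at_right) auto
  moreover have "\<forall>n. q n \<in> time_grid T \<and> s < q n"
  proof
    fix n
    show "q n \<in> time_grid T \<and> s < q n" using q[of n] assms by (simp add: time_grid_def)
  qed
  ultimately show ?thesis by blast
qed

text \<open>The Lipschitz bound is known on the grid only, so the value at s and the left limit are
  both approached along grid points, whose distance tends to 0.\<close>

lemma left_limit_eq_of_lipschitz_on_time_grid:
  fixes f :: "real \<Rightarrow> 'b::real_normed_vector"
  assumes s: "0 < s" "s \<le> T"
    and left: "(f \<longlongrightarrow> l) (at_left s)" and right: "s < T \<Longrightarrow> (f \<longlongrightarrow> f s) (at_right s)"
    and lip: "\<And>t t'. t \<in> time_grid T \<Longrightarrow> t' \<in> time_grid T \<Longrightarrow> t < t' \<Longrightarrow> norm (f t' - f t) \<le> C * (t' - t)"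
  shows "f s = l"
proof -
  obtain q where q: "\<And>n. q n \<in> time_grid T" "\<And>n. q n < s" "filterlim q (at_left s) sequentially"
    using time_grid_sequence_left[OF s] by blast
  obtain q' where q': "\<And>n. q' n \<in> time_grid T" "\<And>n. s \<le> q' n" "q' \<longlonglongrightarrow> s" "(\<lambda>n. f (q' n)) \<longlonglongrightarrow> f s"
  proof (cases "s < T")
    case True
    then obtain p where p: "\<And>n. p n \<in> time_grid T" "\<And>n. s < p n" "filterlim p (at_right s) sequentially"
      using time_grid_sequence_right[of s T] s by auto
    then show thesis
      using filterlim_compose[OF right[OF True] p(3)]
      by (intro that[of p]) (auto intro: less_imp_le simp: filterlim_at)
  next
    \<comment> \<open>Here s = T is itself a grid point, and a constant sequence replaces the
      approach from the right.\<close>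
    case False
    then show thesis
      using s by (intro that[of "\<lambda>_. s"]) (auto simp: time_grid_def)
  qed
  have 1: "(\<lambda>n. norm (f (q' n) - f (q n))) \<longlonglongrightarrow> norm (f s - l)"
    by (intro tendsto_norm tendsto_diff q'(4) filterlim_compose[OF left q(3)])
  have "q \<longlonglongrightarrow> s" using q(3) by (simp add: filterlim_at)
  then have 2: "(\<lambda>n. C * (q' n - q n)) \<longlonglongrightarrow> C * (s - s)"
    by (intro tendsto_mult_left tendsto_diff q'(3))
  have "norm (f (q' n) - f (q n)) \<le> C * (q' n - q n)" for n
    using q(2)[of n] q'(2)[of n] by (intro lip q(1) q'(1)) simp
  then have "norm (f s - l) \<le> C * (s - s)"
    by (intro LIMSEQ_le[OF 1 2]) blast
  then show ?thesis by simp
qed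

lemma (in prob_space) AE_jump_convolution_eq:
  fixes Z :: "real \<Rightarrow> 'a \<Rightarrow> 'h::{banach, second_countable_topology}"
  assumes S: "C0_semigroup S"
    and Z: "\<And>s. 0 \<le> s \<Longrightarrow> Z s \<in> borel_measurable M"
    and cZ: "AE \<omega> in M. cadlag_on {0..} (\<lambda>t. Z t \<omega>)"
    and X: "\<And>t. t \<in> {0..T} \<Longrightarrow> has_stochastic_integral M Z (\<lambda>s. S (t - s)) t (\<lambda>\<omega>. X \<omega> t)"
    and cX: "\<And>\<omega>. \<omega> \<in> space M \<Longrightarrow> cadlag_on {0..T} (X \<omega>)"
  shows "AE \<omega> in M. \<forall>s\<in>{0<..T}. jump (X \<omega>) s = jump (\<lambda>t. Z t \<omega>) s"
proof -
  \<comment> \<open>Countably many smoothing parameters, hence countably many null sets; the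
    Lipschitz constant may depend on m and n.\<close>
  define P where "P m n x = smoothing S (1 / real (Suc m)) (smoothing S (1 / real (Suc n)) x)" for m n x
  have blP: "bounded_linear (P m n)" for m n
    unfolding P_def
    by (rule bounded_linear_compose[OF bounded_linear_smoothing[OF S] bounded_linear_smoothing[OF S]]) auto
  define Y where "Y m n \<omega> t = P m n (X \<omega> t) - P m n (Z t \<omega>)" for m n \<omega> t
  define Q where "Q m n C \<longleftrightarrow> (\<forall>t\<in>time_grid T. \<forall>t'\<in>time_grid T. t < t' \<longrightarrow>
      (AE \<omega> in M. \<forall>V. (\<forall>s\<in>{0..T}. norm (Z s \<omega>) \<le> V) \<longrightarrow> norm (Y m n \<omega> t' - Y m n \<omega> t) \<le> C * (t' - t) * V))"
    for m n C
  have "\<exists>C. Q m n C" for m n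
  proof -
    have hk: "0 \<le> 1 / real (Suc m)" "0 \<le> 1 / real (Suc n)" by simp_all
    show ?thesis
    proof (rule smoothed_convolution_lipschitz[OF S hk Z X, folded P_def, folded Y_def])
      fix C assume "\<And>t t'. 0 < t \<Longrightarrow> t < t' \<Longrightarrow> t' \<le> T \<Longrightarrow>
        AE \<omega> in M. \<forall>V. (\<forall>s\<in>{0..T}. norm (Z s \<omega>) \<le> V) \<longrightarrow> norm (Y m n \<omega> t' - Y m n \<omega> t) \<le> C * (t' - t) * V"
      then have "Q m n C" unfolding Q_def by (simp add: time_grid_def)
      then show ?thesis ..
    qed
  qed
  then obtain C where C: "\<And>m n. Q m n (C m n)" by metis
  have "AE \<omega> in M. \<forall>m n. \<forall>t\<in>time_grid T. \<forall>t'\<in>time_grid T. t < t' \<longrightarrow>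
      (\<forall>V. (\<forall>s\<in>{0..T}. norm (Z s \<omega>) \<le> V) \<longrightarrow> norm (Y m n \<omega> t' - Y m n \<omega> t) \<le> C m n * (t' - t) * V)"
    unfolding AE_all_countable AE_ball_countable[OF countable_time_grid] 
    by (intro allI ballI AE_impI) (use C in \<open>auto simp: Q_def\<close>)
  then show ?thesis
    using cZ AE_space
  proof eventually_elim
    case (elim \<omega>)
    have z: "cadlag_on {0..T} (\<lambda>t. Z t \<omega>)" using elim(2) by (rule cadlag_on_subset) auto
    have x: "cadlag_on {0..T} (X \<omega>)" using elim(3) by (rule cX)
    obtain V where V: "\<forall>s\<in>{0..T}. norm (Z s \<omega>) \<le> V" using cadlag_on_bounded[OF z] by blast
    show ?case
    proof
      fix s assume "s \<in> {0<..T}"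
      then have s: "0 < s" "s \<le> T" by auto
      have P0: "P m n (jump (X \<omega>) s - jump (\<lambda>t. Z t \<omega>) s) = 0" for m n
      proof -
        have "Y m n \<omega> s = P m n (X \<omega> s - jump (X \<omega>) s) - P m n (Z s \<omega> - jump (\<lambda>t. Z t \<omega>) s)"
        proof (rule left_limit_eq_of_lipschitz_on_time_grid[OF s, where C = "C m n * V"])
          show "(Y m n \<omega> \<longlongrightarrow> P m n (X \<omega> s - jump (X \<omega>) s) - P m n (Z s \<omega> - jump (\<lambda>t. Z t \<omega>) s)) (at_left s)"
            unfolding Y_def
            by (intro tendsto_diff bounded_linear.tendsto[OF blP] cadlag_on_tendsto_left[OF x s] cadlag_on_tendsto_left[OF z s])
          show "(Y m n \<omega> \<longlongrightarrow> Y m n \<omega> s) (at_right s)" if "s < T"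
            unfolding Y_def using s that
            by (intro tendsto_diff bounded_linear.tendsto[OF blP] cadlag_on_tendsto_right[OF x] cadlag_on_tendsto_right[OF z]) auto
          show "norm (Y m n \<omega> t' - Y m n \<omega> t) \<le> C m n * V * (t' - t)"
            if "t \<in> time_grid T" "t' \<in> time_grid T" "t < t'" for t t'
            using elim(1) that V by (simp add: ac_simps)
        qed
        then show ?thesis
          unfolding Y_def using linear_diff[OF bounded_linear.linear[OF blP]] by simp
      qed
      \<comment> \<open>With n fixed, letting m vary removes the outer smoothing; letting n vary
        then removes the inner one.\<close>
      have "smoothing S (1 / real (Suc n)) (jump (X \<omega>) s - jump (\<lambda>t. Z t \<omega>) s) = 0" for n
      proof (rule smoothing_eq_0_imp_eq_0[OF S])
        show "smoothing S (1 / real (Suc m)) (smoothing S (1 / real (Suc n)) (jump (X \<omega>) s - jump (\<lambda>t. Z t \<omega>) s)) = 0" for m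
          using P0[of m n] unfolding P_def .
      qed
      then have "jump (X \<omega>) s - jump (\<lambda>t. Z t \<omega>) s = 0"
        by (rule smoothing_eq_0_imp_eq_0[OF S])
      then show "jump (X \<omega>) s = jump (\<lambda>t. Z t \<omega>) s" by simp
    qed
  qed
qed

text \<open>For e \<le> 1 the compensated small jumps and the large jumps add up to all jumps of
  norm at least e minus a deterministic vector. As e and c are chosen before any path is seen, the
  same formula can be evaluated on every path with the jumps of \<open>Z\<close>.\<close>

lemma (in prob_space) purely_jump_recovery:
  fixes Z :: "real \<Rightarrow> 'a \<Rightarrow> 'h::{banach, second_countable_topology}"
  assumes J: "purely_jump M Z"
    and Z: "\<And>s. 0 \<le> s \<Longrightarrow> Z s \<in> borel_measurable M"
    and cZ: "AE \<omega> in M. cadlag_on {0..} (\<lambda>t. Z t \<omega>)" and t: "0 \<le> t"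
  shows "\<exists>e c. (\<forall>n. 0 < e n) \<and> (AE \<omega> in M. (\<lambda>n. jump_sum_lim (e n) t (\<lambda>s. Z s \<omega>) - c n) \<longlonglongrightarrow> Z t \<omega>)"
proof -
  define e where "e n = 1 / real (Suc n)" for n
  have e: "0 < e n" "e n \<le> 1" for n by (simp_all add: e_def)
  define c where "c n = t *\<^sub>R (LINT x:{x. e n \<le> norm x \<and> norm x < 1}|levy_measure M Z. x)" for n
  define u where "u n \<omega> = jump_sum_lim (e n) t (\<lambda>s. Z s \<omega>) - c n - Z t \<omega>" for n \<omega>
  have [measurable]: "u n \<in> borel_measurable M" for n
    unfolding u_def using Z t by (intro borel_measurable_diff borel_measurable_jump_sum_lim) auto
  have "e \<longlonglongrightarrow> 0" unfolding e_def by (rule uniform_mesh_tendsto_0)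
  then have e_lim: "filterlim e (at_right 0) sequentially"
    using e by (intro tendsto_imp_filterlim_at_right) auto
  have "((\<lambda>\<epsilon>. \<integral>\<^sup>+\<omega>. ennreal ((norm (Z t \<omega> -
          (compensated_small_jumps M Z \<epsilon> t \<omega> + large_jumps Z t \<omega>)))\<^sup>2) \<partial>M) \<longlongrightarrow> 0) (at_right 0)"
    using J t unfolding purely_jump_def by blast
  note lim = filterlim_compose[OF this e_lim]
  have "(\<integral>\<^sup>+\<omega>. ennreal ((norm (Z t \<omega> - (compensated_small_jumps M Z (e n) t \<omega> + large_jumps Z t \<omega>)))\<^sup>2) \<partial>M)
      = (\<integral>\<^sup>+\<omega>. ennreal ((norm (u n \<omega>))\<^sup>2) \<partial>M)" for n
  proof (rule nn_integral_cong_AE)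
    show "AE \<omega> in M. ennreal ((norm (Z t \<omega> - (compensated_small_jumps M Z (e n) t \<omega> + large_jumps Z t \<omega>)))\<^sup>2)
        = ennreal ((norm (u n \<omega>))\<^sup>2)"
      using cZ
    proof eventually_elim
      case (elim \<omega>)
      have z: "cadlag_on {0..t} (\<lambda>t. Z t \<omega>)" using elim by (rule cadlag_on_subset) auto
      have B: "{x :: 'h. e n \<le> norm x} = {x. e n \<le> norm x \<and> norm x < 1} \<union> {x. 1 \<le> norm x}"
        using e[of n] by auto
      have "jump_sum_lim (e n) t (\<lambda>s. Z s \<omega>) = jump_sum (\<lambda>s. Z s \<omega>) t {x. e n \<le> norm x}"
        by (rule jump_sum_lim_eq[OF z t e(1)])
      also have "\<dots> = jump_sum (\<lambda>s. Z s \<omega>) t {x. e n \<le> norm x \<and> norm x < 1} + large_jumps Z t \<omega>"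
        unfolding B large_jumps_def using jump_sum_lim_eq(2)[OF z t e(1), of n, unfolded B]
        by (intro jump_sum_add_disjoint[symmetric]) auto
      finally have "u n \<omega> = - (Z t \<omega> - (compensated_small_jumps M Z (e n) t \<omega> + large_jumps Z t \<omega>))"
        by (simp add: u_def c_def compensated_small_jumps_def)
      then show ?case by (simp only: norm_minus_cancel)
    qed
  qed
  with lim have "(\<lambda>n. \<integral>\<^sup>+\<omega>. ennreal ((norm (u n \<omega>))\<^sup>2) \<partial>M) \<longlonglongrightarrow> 0" by simp
  then have "(\<lambda>n. measure M {\<omega> \<in> space M. \<epsilon> < norm (u n \<omega>)}) \<longlonglongrightarrow> 0" if "\<epsilon> > 0" for \<epsilon>
    using that by (intro tendsto_in_probability_of_nn_integral_square) auto
  then obtain r :: "nat \<Rightarrow> nat" where "AE \<omega> in M. (\<lambda>n. u (r n) \<omega>) \<longlonglongrightarrow> 0"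
    using AE_subseq_of_tendsto_in_probability[of u] by auto
  then have "AE \<omega> in M. (\<lambda>n. jump_sum_lim (e (r n)) t (\<lambda>s. Z s \<omega>) - c (r n)) \<longlonglongrightarrow> Z t \<omega>"
    by (simp add: u_def LIM_zero_iff)
  then show ?thesis
    using e by (intro exI[of _ "\<lambda>n. e (r n)"] exI[of _ "\<lambda>n. c (r n)"]) auto
qed

lemma jump_sum_cong:
  assumes "\<And>s. 0 < s \<Longrightarrow> s \<le> t \<Longrightarrow> jump f s = jump g s"
  shows "jump_sum f t B = jump_sum g t B"
proof -
  have "jump_times f t B = jump_times g t B" using assms by (auto simp: jump_times_def)
  then show ?thesis
    unfolding jump_sum_def by (intro sum.cong) (auto simp: jump_times_def assms)
qed

lemma skorokhod_space_cadlag: "f \<in> space (skorokhod_space T) \<Longrightarrow> cadlag_on {0..T} f"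
  by (simp add: skorokhod_space_def space_restrict_space)

lemma measurable_skorokhod_eval:
  "s \<in> {0..T} \<Longrightarrow> (\<lambda>f. f s) \<in> borel_measurable (skorokhod_space T)"
  unfolding skorokhod_space_def by (intro measurable_restrict_space1 measurable_component_singleton)

section \<open>Transfer between the laws\<close>

theorem theoremB:
  fixes M :: "'w measure"
    and Z :: "real \<Rightarrow> 'w \<Rightarrow> 'h::{real_inner, banach, second_countable_topology}"
    and A A' :: "'h \<Rightarrow> 'h" and DA DA' :: "'h set"
    and S S' :: "real \<Rightarrow> 'h \<Rightarrow>\<^sub>L 'h"
    and X X' :: "'w \<Rightarrow> real \<Rightarrow> 'h"
    and T :: real
  assumes "prob_space M"
    and "T > 0"
    and "generates_C0_semigroup DA A S"
    and "generates_C0_semigroup DA' A' S'"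
    and "levy_process M Z"
    and "purely_jump M Z"
    and "stochastic_convolution M T S Z X"
    and "stochastic_convolution M T S' Z X'"
    and "absolutely_continuous (distr M (skorokhod_space T) X') (distr M (skorokhod_space T) X)"
  shows "AE \<omega> in M. \<forall>t\<in>{0..T}. X \<omega> t = X' \<omega> t"
proof -
  interpret prob_space M by fact
  have Z: "Z s \<in> borel_measurable M" if "0 \<le> s" for s
    using \<open>levy_process M Z\<close> that by (simp add: levy_process_def)
  have cZ: "AE \<omega> in M. cadlag_on {0..} (\<lambda>t. Z t \<omega>)"
    using \<open>levy_process M Z\<close> by (simp add: levy_process_def)
  have S: "C0_semigroup S" "C0_semigroup S'"
    using assms(3,4) by (simp_all add: generates_C0_semigroup_def)
  have X [measurable]: "X \<in> M \<rightarrow>\<^sub>M skorokhod_space T" "X' \<in> M \<rightarrow>\<^sub>M skorokhod_space T"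
    and iX: "\<And>t. t \<in> {0..T} \<Longrightarrow> has_stochastic_integral M Z (\<lambda>s. S (t - s)) t (\<lambda>\<omega>. X \<omega> t)"
      "\<And>t. t \<in> {0..T} \<Longrightarrow> has_stochastic_integral M Z (\<lambda>s. S' (t - s)) t (\<lambda>\<omega>. X' \<omega> t)"
    using assms(7,8) by (auto simp: stochastic_convolution_def)
  have cX: "cadlag_on {0..T} (X \<omega>)" "cadlag_on {0..T} (X' \<omega>)" if "\<omega> \<in> space M" for \<omega>
    using measurable_space[OF X(1) that] measurable_space[OF X(2) that] by (auto intro: skorokhod_space_cadlag)
  define R where "R t e c \<longleftrightarrow> (\<forall>n. 0 < e n) \<and>
      (AE \<omega> in M. (\<lambda>n. jump_sum_lim (e n) t (\<lambda>s. Z s \<omega>) - c n) \<longlonglongrightarrow> Z t \<omega>)"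
    for t and e :: "nat \<Rightarrow> real" and c
  have "\<exists>e c. R t e c" if "0 \<le> t" for t
    unfolding R_def by (rule purely_jump_recovery[OF \<open>purely_jump M Z\<close> Z cZ that])
  then obtain e c where "\<And>t. 0 \<le> t \<Longrightarrow> R t (e t) (c t)" by metis
  then have e: "\<And>t n. 0 \<le> t \<Longrightarrow> 0 < e t n"
    and rec: "\<And>t. 0 \<le> t \<Longrightarrow> AE \<omega> in M. (\<lambda>n. jump_sum_lim (e t n) t (\<lambda>s. Z s \<omega>) - c t n) \<longlonglongrightarrow> Z t \<omega>"
    unfolding R_def by blast+
  \<comment> \<open>\<open>lim\<close> has some value even for divergent sequences, so \<zeta> s is
    defined and measurable on the whole path space; agreement with \<open>Z\<close> is claimed only
    almost surely, along any process with the jumps of \<open>Z\<close>.\<close>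
  define \<zeta> where "\<zeta> s f = lim (\<lambda>n. jump_sum_lim (e s n) s f - c s n)" for s and f :: "real \<Rightarrow> 'h"
  have \<zeta>_meas: "\<zeta> s \<in> borel_measurable (skorokhod_space T)" if "0 \<le> s" "s \<le> T" for s
    unfolding \<zeta>_def using that
    by (intro borel_measurable_lim_metric borel_measurable_diff borel_measurable_jump_sum_lim measurable_skorokhod_eval) auto
  have \<zeta>_eq: "AE \<omega> in M. \<zeta> s (U \<omega>) = Z s \<omega>"
    if s: "0 \<le> s" "s \<le> T"
      and U: "AE \<omega> in M. \<forall>s\<in>{0<..T}. jump (U \<omega>) s = jump (\<lambda>t. Z t \<omega>) s"
      and cU: "\<And>\<omega>. \<omega> \<in> space M \<Longrightarrow> cadlag_on {0..T} (U \<omega>)" for s U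
    using U rec[OF s(1)] cZ AE_space
  proof eventually_elim
    case (elim \<omega>)
    have z: "cadlag_on {0..s} (\<lambda>t. Z t \<omega>)" using elim(3) by (rule cadlag_on_subset) auto
    have u: "cadlag_on {0..s} (U \<omega>)" using cU[OF elim(4)] by (rule cadlag_on_subset) (use s in auto)
    have "jump_sum_lim (e s n) s (U \<omega>) = jump_sum_lim (e s n) s (\<lambda>t. Z t \<omega>)" for n
      unfolding jump_sum_lim_eq(1)[OF z s(1) e[OF s(1)]] jump_sum_lim_eq(1)[OF u s(1) e[OF s(1)]]
      using elim(1) s by (intro jump_sum_cong) auto
    then show ?case using elim(2) by (simp add: \<zeta>_def limI)
  qed
  note jX = AE_jump_convolution_eq[OF S(1) Z cZ iX(1) cX(1)]
    and jX' = AE_jump_convolution_eq[OF S(2) Z cZ iX(2) cX(2)]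
  have at: "AE \<omega> in M. X \<omega> t = X' \<omega> t" if t: "t \<in> time_grid T" for t
  proof -
    have t: "0 < t" "t \<le> T" using t by (auto simp: time_grid_def)
    define p where "p k i = t * real i / real (Suc k)" for k i
    have part: "partition_of t (Suc k) (p k)" for k
      unfolding p_def by (rule partition_of_uniform[OF t(1)])
    have mesh: "p k (Suc i) - p k i \<le> t / real (Suc k)" for k i
      unfolding p_def uniform_mesh ..
    have "has_stochastic_integral M Z (\<lambda>s. S' (t - s)) t (\<lambda>\<omega>. X' \<omega> t)" using t by (intro iX) auto
    from has_stochastic_integral_AE_subseq[OF this part mesh uniform_mesh_tendsto_0 Z]
    obtain r :: "nat \<Rightarrow> nat" where
      r: "AE \<omega> in M. (\<lambda>k. stochastic_sum Z (\<lambda>s. S' (t - s)) (Suc (r k)) (p (r k)) \<omega>) \<longlonglongrightarrow> X' \<omega> t"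
      by blast
    \<comment> \<open>The sums approximating X'(t), taken over the path space with \<zeta> as the
      driving process. Partitions and subsequence are fixed beforehand, so this is one functional
      for all paths.\<close>
    define \<Psi> where "\<Psi> f = lim (\<lambda>k. stochastic_sum \<zeta> (\<lambda>s. S' (t - s)) (Suc (r k)) (p (r k)) f)" for f
    have [measurable]: "\<Psi> \<in> borel_measurable (skorokhod_space T)"
      unfolding \<Psi>_def using t
      by (intro borel_measurable_lim_metric borel_measurable_stochastic_sum[OF part] \<zeta>_meas) auto
    have [measurable]: "(\<lambda>f. f t) \<in> borel_measurable (skorokhod_space T)"
      using t by (intro measurable_skorokhod_eval) auto
    have \<Psi>_eq: "AE \<omega> in M. \<Psi> (U \<omega>) = X' \<omega> t"
      if "\<And>s. 0 \<le> s \<Longrightarrow> s \<le> T \<Longrightarrow> AE \<omega> in M. \<zeta> s (U \<omega>) = Z s \<omega>" for U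
    proof -
      \<comment> \<open>The null set in \<open>that\<close> depends on the time s; only the
        countably many points of the chosen partitions matter.\<close>
      have "AE \<omega> in M. \<forall>k. \<forall>i\<in>{..Suc (r k)}. \<zeta> (p (r k) i) (U \<omega>) = Z (p (r k) i) \<omega>"
        unfolding AE_all_countable
      proof (intro allI AE_finite_allI)
        fix k i assume "i \<in> {..Suc (r k)}"
        then show "AE \<omega> in M. \<zeta> (p (r k) i) (U \<omega>) = Z (p (r k) i) \<omega>"
          using partition_of_nonneg[OF part, of i "r k"] partition_of_le[OF part, of i "r k"] t
          by (intro that) auto
      qed simp
      then show ?thesis
        using r
      proof eventually_elim
        case (elim \<omega>)
        have "stochastic_sum \<zeta> (\<lambda>s. S' (t - s)) (Suc (r k)) (p (r k)) (U \<omega>)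
            = stochastic_sum Z (\<lambda>s. S' (t - s)) (Suc (r k)) (p (r k)) \<omega>" for k
          unfolding stochastic_sum_def using elim(1) by (intro sum.cong) auto
        then show ?case using elim(2) by (simp add: \<Psi>_def limI)
      qed
    qed
    have "AE \<omega> in M. \<Psi> (X' \<omega>) = X' \<omega> t" by (intro \<Psi>_eq \<zeta>_eq jX' cX(2))
    then have "AE f in distr M (skorokhod_space T) X'. \<Psi> f = f t"
      by (subst AE_distr_iff) auto
    then have "AE f in distr M (skorokhod_space T) X. \<Psi> f = f t"
      by (rule absolutely_continuous_AE[OF _ assms(9), rotated]) simp
    then have "AE \<omega> in M. \<Psi> (X \<omega>) = X \<omega> t"
      by (subst (asm) AE_distr_iff) auto
    \<comment> \<open>\<Psi> is built from \<open>S'\<close> and sees only the jumps of its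
      argument; fed with X, which has the jumps of \<open>Z\<close>, it still returns X'(t).\<close>
    moreover have "AE \<omega> in M. \<Psi> (X \<omega>) = X' \<omega> t" by (intro \<Psi>_eq \<zeta>_eq jX cX(1))
    ultimately show ?thesis by eventually_elim simp
  qed
  have "AE \<omega> in M. \<forall>t\<in>time_grid T. X \<omega> t = X' \<omega> t"
    unfolding AE_ball_countable[OF countable_time_grid] using at by blast
  then show ?thesis
    using AE_space
  proof eventually_elim
    case (elim \<omega>)
    show ?case
    proof
      fix t assume t: "t \<in> {0..T}"
      show "X \<omega> t = X' \<omega> t"
      proof (cases "t < T")
        case True
        then obtain q where q: "\<And>n. q n \<in> time_grid T" "filterlim q (at_right t) sequentially"
          using time_grid_sequence_right[of t T] t by auto
        have "(\<lambda>n. X \<omega> (q n)) \<longlonglongrightarrow> X \<omega> t" "(\<lambda>n. X' \<omega> (q n)) \<longlonglongrightarrow> X' \<omega> t"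
          using t True by (auto intro!: filterlim_compose[OF cadlag_on_tendsto_right[OF cX(1)[OF elim(2)]] q(2)]
              filterlim_compose[OF cadlag_on_tendsto_right[OF cX(2)[OF elim(2)]] q(2)])
        then show ?thesis using elim(1) q(1) by (auto intro: LIMSEQ_unique)
      next
        case False
        then show ?thesis using t elim(1) \<open>T > 0\<close> by (auto simp: time_grid_def)
      qed
    qed
  qed
qed

end
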